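(* Let $\mu$ be a probability measure on the unit circle (identified with $\mathbb{R}/(2\pi\mathbb{Z})$) that is not supported on a finite number of points, and let $\{\alpha_n\}_{n\ge 0}$ be its Verblunsky coefficients. Suppose there is $A<\infty$ such that $$\sum_{n=0}^{N}(n+1)|\alpha_n|^2\le A\log N\qquad\text{for all integers } N\ge 2 .$$ Then $\mu_{\rm sc}=0$, i.e. the singular continuous part of $\mu$ (with respect to Lebesgue measure) vanishes.
   Context: Let $\mu$ be a probability measure on $\mathbb{R}/(2\pi\mathbb{Z})$ not supported on finitely many points. Its monic orthogonal polynomials $\Phi_n(z)$ (monic of degree $n$, orthogonal in $L^2(\mu)$ when evaluated at $z=e^{i\eta}$) obey $\Phi_0=1$ and the Szegő recursion $\Phi_{n+1}(z)=z\Phi_n(z)-\overline{\alpha_n}\,\Phi_n^*(z)$, where $\Phi_n^*(z)=z^n\overline{\Phi_n(1/\overline z)}$. The numbers $\alpha_n\in\mathbb{D}=\{z\in\mathbb{C}:|z|<1\}$, $n\ge 0$, are the Verblunsky coefficients of $\mu$; conversely every sequence in $\mathbb{D}$ arises from a unique such measure. The Lebesgue decomposition is $\mu=\mu_{\rm ac}+\mu_{\rm sc}+\mu_{\rm pp}$ into absolutely continuous (with respect to Lebesgue measure), singular continuous and pure point parts. *)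

theory Defs
  imports "HOL-Analysis.Analysis" "HOL-Computational_Algebra.Polynomial" "HOL-Probability.Probability_Measure"
begin

section \<open>Measures on the unit circle\<close>

text \<open>
  The group of reals modulo $2\pi$ is identified with the unit circle of the complex plane
  via $\eta \mapsto e^{i\eta}$. Lebesgue measure is the (unnormalised) arc length measure.
\<close>

definition circle_borel :: "complex measure" where
  "circle_borel = restrict_space borel (sphere 0 1)"

definition circle_lebesgue :: "complex measure" where
  "circle_lebesgue = distr (restrict_space lborel {0..<2 * pi}) circle_borel cis"

definition finitely_supported :: "'a measure \<Rightarrow> bool" where
  "finitely_supported M \<longleftrightarrow> (\<exists>F. finite F \<and> (AE x in M. x \<in> F))"

lemma measurable_cis_circle_borel:
  "cis \<in> restrict_space lborel {0..<2 * pi} \<rightarrow>\<^sub>M circle_borel"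
  unfolding circle_borel_def
proof (rule measurable_restrict_space2)
  have "cis \<in> borel \<rightarrow>\<^sub>M borel"
    by (intro borel_measurable_continuous_onI continuous_intros)
  then show "cis \<in> restrict_space lborel {0..<2 * pi} \<rightarrow>\<^sub>M borel"
    by (intro measurable_restrict_space1) simp
qed simp

lemma sets_circle_lebesgue [simp]: "sets circle_lebesgue = sets circle_borel"
  by (simp add: circle_lebesgue_def)

lemma singleton_in_sets_circle_borel: "norm z = 1 \<Longrightarrow> {z} \<in> sets circle_borel"
  unfolding circle_borel_def by (subst sets_restrict_space_iff) auto


section \<open>Orthogonal polynomials and Verblunsky coefficients\<close>

definition monic_orthogonal_polys :: "complex measure \<Rightarrow> (nat \<Rightarrow> complex poly) \<Rightarrow> bool" where
  "monic_orthogonal_polys M \<Phi> \<longleftrightarrow>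
     (\<forall>n. degree (\<Phi> n) = n \<and> lead_coeff (\<Phi> n) = 1) \<and>
     (\<forall>m n. m \<noteq> n \<longrightarrow> (LINT z|M. poly (\<Phi> m) z * cnj (poly (\<Phi> n) z)) = 0)"

text \<open>The reversed polynomial $p^*(z) = z^n \overline{p(1/\overline z)}$, where $n$ is the degree of $p$.\<close>

definition reversed_poly :: "complex poly \<Rightarrow> complex poly" where
  "reversed_poly p = reflect_poly (map_poly cnj p)"

lemma poly_reversed_poly:
  assumes "z \<noteq> 0"
  shows "poly (reversed_poly p) z = z ^ degree p * cnj (poly p (1 / cnj z))"
  using assms
  by (simp add: reversed_poly_def poly_reflect_poly_nz degree_map_poly inverse_eq_divide)

definition verblunsky_coeffs :: "complex measure \<Rightarrow> (nat \<Rightarrow> complex) \<Rightarrow> bool" where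
  "verblunsky_coeffs M \<alpha> \<longleftrightarrow>
     (\<exists>\<Phi>. monic_orthogonal_polys M \<Phi> \<and>
        (\<forall>n. \<Phi> (Suc n) = [:0, 1:] * \<Phi> n - smult (cnj (\<alpha> n)) (reversed_poly (\<Phi> n))))"

text \<open>
  The definition is never void: every probability measure on the circle without finite support
  has Verblunsky coefficients, see \<open>verblunsky_coeffs_exist\<close>.
\<close>

context
  fixes M :: "complex measure"
  assumes prob: "prob_space M" and setsM: "sets M = sets circle_borel"
    and inf: "\<not> finitely_supported M"
begin

interpretation prob_space M by (rule prob)

lemma space_circle_measure: "space M = sphere 0 1"
  using sets_eq_imp_space_eq[OF setsM] by (simp add: circle_borel_def space_restrict_space)

lemma integrable_circle_continuous:
  assumes "continuous_on UNIV (f :: complex \<Rightarrow> complex)"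
  shows "integrable M f"
proof -
  have m: "f \<in> borel_measurable M"
    using borel_measurable_continuous_onI[OF assms]
    unfolding measurable_cong_sets[OF setsM refl] circle_borel_def
    by (rule measurable_restrict_space1)
  have "compact (f ` sphere 0 1)"
    using assms by (intro compact_continuous_image) (auto intro: continuous_on_subset)
  then obtain B where B: "\<And>z. z \<in> sphere 0 1 \<Longrightarrow> norm (f z) \<le> B"
    using compact_imp_bounded[of "f ` sphere 0 1"] unfolding bounded_iff by blast
  show ?thesis
    by (rule integrable_const_bound[of _ B]) (use B m space_circle_measure in auto)
qed

definition poly_ip where "poly_ip p q = (LINT z|M. poly p z * cnj (poly q z))"

lemma integrable_poly_prod: "integrable M (\<lambda>z. poly p z * cnj (poly q z))"
  by (intro integrable_circle_continuous continuous_intros)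

lemma poly_ip_sum: "poly_ip p (\<Sum>k\<in>A. smult (c k) (q k)) = (\<Sum>k\<in>A. cnj (c k) * poly_ip p (q k))"
proof -
  have "poly_ip p (\<Sum>k\<in>A. smult (c k) (q k)) = (LINT z|M. (\<Sum>k\<in>A. cnj (c k) * (poly p z * cnj (poly (q k) z))))"
    unfolding poly_ip_def by (intro Bochner_Integration.integral_cong) (auto simp: poly_sum sum_distrib_left mult_ac)
  also have "\<dots> = (\<Sum>k\<in>A. cnj (c k) * poly_ip p (q k))"
    unfolding poly_ip_def by (subst Bochner_Integration.integral_sum) (auto intro!: integrable_mult_right integrable_poly_prod)
  finally show ?thesis .
qed

lemma poly_ip_orth:
  assumes "\<And>k. k < n \<Longrightarrow> poly_ip p (monom 1 k) = 0" "degree q \<le> n"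
  shows "poly_ip p q = cnj (coeff q n) * poly_ip p (monom 1 n)"
proof -
  have "q = (\<Sum>k\<le>n. smult (coeff q k) (monom 1 k))"
    using poly_as_sum_of_monoms'[OF assms(2)] by (simp add: smult_monom)
  then have "poly_ip p q = (\<Sum>k\<le>n. cnj (coeff q k) * poly_ip p (monom 1 k))"
    by (metis poly_ip_sum)
  also have "\<dots> = (\<Sum>k\<in>{n}. cnj (coeff q k) * poly_ip p (monom 1 k))"
    using assms(1) by (intro sum.mono_neutral_right) auto
  finally show ?thesis by simp
qed

lemma poly_ip_self_nonzero: assumes "p \<noteq> 0" shows "poly_ip p p \<noteq> 0"
proof
  assume "poly_ip p p = 0"
  have "poly_ip p p = (LINT z|M. complex_of_real ((norm (poly p z))\<^sup>2))"
    unfolding poly_ip_def by (simp only: complex_norm_square)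
  also have "\<dots> = complex_of_real (LINT z|M. (norm (poly p z))\<^sup>2)"
    by (rule integral_complex_of_real)
  finally have 0: "(LINT z|M. (norm (poly p z))\<^sup>2) = 0"
    using \<open>poly_ip p p = 0\<close> by simp
  have "integrable M (\<lambda>z. complex_of_real ((norm (poly p z))\<^sup>2))"
    using integrable_poly_prod[of p p] by (simp only: complex_norm_square)
  then have "integrable M (\<lambda>z. (norm (poly p z))\<^sup>2)"
    by (simp only: complex_of_real_integrable_eq)
  then have "AE z in M. (norm (poly p z))\<^sup>2 = 0"
    using 0 by (subst integral_nonneg_eq_0_iff_AE[symmetric]) auto
  then have "AE z in M. z \<in> {z. poly p z = 0}" by simp
  with poly_roots_finite[OF assms] inf show False
    unfolding finitely_supported_def by blast
qed

lemma poly_reversed_poly_circle: "norm z = 1 \<Longrightarrow> poly (reversed_poly p) z = z ^ degree p * cnj (poly p z)"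
proof -
  assume z: "norm z = 1"
  then have "z \<noteq> 0" by auto
  moreover have "1 / cnj z = z" using z by (metis complex_cnj_cnj complex_norm_square div_by_1 divide_eq_eq mult.commute nonzero_divide_eq_eq of_real_1 power_one norm_zero zero_neq_one complex_cnj_zero_iff)
  ultimately show ?thesis by (simp add: poly_reversed_poly)
qed

lemma szego_step:
  assumes "degree p = n" "lead_coeff p = 1" "\<And>k. k < n \<Longrightarrow> poly_ip p (monom 1 k) = 0"
  shows "\<exists>a. let q = [:0, 1:] * p - smult (cnj a) (reversed_poly p) in
     degree q = Suc n \<and> lead_coeff q = 1 \<and> (\<forall>k<Suc n. poly_ip q (monom 1 k) = 0)"
proof -
  let ?r = "reversed_poly p" and ?z = "[:0,1:] * p"
  have p0: "p \<noteq> 0" using assms(2) by auto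
  have zz: "cnj z * z = 1" if "norm z = 1" for z
    using that by (metis complex_norm_square mult.commute of_real_1 power_one)
  have zzk: "z ^ n * cnj z ^ k = z ^ (n - k)" if "norm z = 1" "k \<le> n" for z k
  proof -
    have "z ^ n * cnj z ^ k = z ^ (n - k) * (cnj z * z) ^ k"
      using that(2) by (simp add: power_mult_distrib power_add[symmetric])
    then show ?thesis using zz that by simp
  qed
  have r: "poly_ip ?r (monom 1 k) = cnj (poly_ip p (monom 1 (n - k)))" if "k \<le> n" for k
  proof -
    have "poly_ip ?r (monom 1 k) = (LINT z|M. cnj (poly p z * cnj (poly (monom 1 (n-k)) z)))"
      unfolding poly_ip_def
    proof (intro Bochner_Integration.integral_cong refl)
      fix z assume "z \<in> space M"
      then have z: "norm z = 1" by (simp add: space_circle_measure)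
      show "poly ?r z * cnj (poly (monom 1 k) z) = cnj (poly p z * cnj (poly (monom 1 (n-k)) z))"
        using zzk[OF z that] by (simp add: poly_reversed_poly_circle[OF z] assms(1) poly_monom mult_ac)
    qed
    then show ?thesis unfolding poly_ip_def by (simp only: Bochner_Integration.integral_cnj)
  qed
  have zi: "poly_ip ?z (monom 1 (Suc k)) = poly_ip p (monom 1 k)" for k
    unfolding poly_ip_def
  proof (intro Bochner_Integration.integral_cong refl)
    fix z assume "z \<in> space M"
    then have z: "norm z = 1" by (simp add: space_circle_measure)
    have "poly ?z z * cnj (poly (monom 1 (Suc k)) z) = (cnj z * z) * (poly p z * cnj z ^ k)"
      by (simp add: poly_monom mult_ac)
    then show "poly ?z z * cnj (poly (monom 1 (Suc k)) z) = poly p z * cnj (poly (monom 1 k) z)"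
      using zz[OF z] by (simp add: poly_monom)
  qed
  have "poly_ip p p = poly_ip p (monom 1 n)"
    using poly_ip_orth[of n p p] assms by simp
  then have nz: "poly_ip ?r (monom 1 0) \<noteq> 0" using r[of 0] poly_ip_self_nonzero[OF p0] by simp
  define a where "a = cnj (poly_ip ?z (monom 1 0) / poly_ip ?r (monom 1 0))"
  let ?q = "?z - smult (cnj a) ?r"
  have lin: "poly_ip ?q s = poly_ip ?z s - cnj a * poly_ip ?r s" for s
  proof -
    have "poly_ip ?q s = (LINT z|M. poly ?z z * cnj (poly s z) - cnj a * (poly ?r z * cnj (poly s z)))"
      unfolding poly_ip_def by (intro Bochner_Integration.integral_cong) (auto simp: algebra_simps)
    also have "\<dots> = poly_ip ?z s - cnj a * poly_ip ?r s"
      unfolding poly_ip_def using integrable_poly_prod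
      by (subst Bochner_Integration.integral_diff) (auto intro!: integrable_mult_right simp del: poly_mult poly_pCons)
    finally show ?thesis .
  qed
  have dr: "degree ?r < Suc n"
    using degree_reflect_poly_le[of "map_poly cnj p"] assms(1) by (simp add: reversed_poly_def degree_map_poly)
  have dz: "degree ?z = Suc n" "lead_coeff ?z = 1"
    using p0 assms(1,2) by (simp_all add: degree_mult_eq lead_coeff_mult)
  have ds: "degree (smult (cnj a) ?r) < degree ?z" using dr dz by (metis degree_smult_le le_less_trans)
  have d: "degree ?q = Suc n"
    using degree_add_eq_left[of "- smult (cnj a) ?r" ?z] ds dz by (simp del: mult_pCons_left)
  moreover have "coeff ?q (Suc n) = 1"
    using dz ds coeff_eq_0[of "smult (cnj a) ?r" "Suc n"] by (simp del: mult_pCons_left)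
  moreover have "poly_ip ?q (monom 1 k) = 0" if "k < Suc n" for k
  proof (cases k)
    case 0
    then show ?thesis using nz unfolding lin by (simp add: a_def)
  next
    case (Suc j)
    then show ?thesis using that r[of k] zi[of j] assms(3)[of j] assms(3)[of "n - k"] by (simp only: lin) simp
  qed
  ultimately show ?thesis by (intro exI[of _ a]) (simp only: Let_def, simp del: mult_pCons_left)
qed

lemma verblunsky_coeffs_exist: "\<exists>\<alpha>. verblunsky_coeffs M \<alpha>"
proof -
  let ?P = "\<lambda>n p. degree p = n \<and> lead_coeff p = 1 \<and> (\<forall>k<n. poly_ip p (monom 1 k) = 0)"
  have "\<exists>\<Phi>. \<forall>n. ?P n (\<Phi> n) \<and> (\<exists>a. \<Phi> (Suc n) = [:0, 1:] * \<Phi> n - smult (cnj a) (reversed_poly (\<Phi> n)))"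
  proof (rule dependent_nat_choice)
    show "\<exists>x. ?P 0 x" by (intro exI[of _ 1]) auto
  next
    fix p n assume "?P n p"
    then show "\<exists>q. ?P (Suc n) q \<and> (\<exists>a. q = [:0, 1:] * p - smult (cnj a) (reversed_poly p))"
      using szego_step[of p n] unfolding Let_def by blast
  qed
  then obtain \<Phi> where P: "\<And>n. ?P n (\<Phi> n)"
    and "\<And>n. \<exists>a. \<Phi> (Suc n) = [:0, 1:] * \<Phi> n - smult (cnj a) (reversed_poly (\<Phi> n))" by blast
  then obtain \<alpha> where \<alpha>: "\<And>n. \<Phi> (Suc n) = [:0, 1:] * \<Phi> n - smult (cnj (\<alpha> n)) (reversed_poly (\<Phi> n))"
    by metis
  have lt: "poly_ip (\<Phi> n) (\<Phi> m) = 0" if "m < n" for m n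
    using poly_ip_orth[of m "\<Phi> n" "\<Phi> m"] P[of m] P[of n] that by simp
  have sym: "poly_ip p q = cnj (poly_ip q p)" for p q
    unfolding poly_ip_def by (subst Bochner_Integration.integral_cnj[symmetric]) (simp add: mult.commute del: Bochner_Integration.integral_cnj)
  have "poly_ip (\<Phi> m) (\<Phi> n) = 0" if "m \<noteq> n" for m n
    using that lt[of m n] lt[of n m] sym[of "\<Phi> m" "\<Phi> n"] by (cases "m < n") auto
  then have "monic_orthogonal_polys M \<Phi>"
    using P unfolding monic_orthogonal_polys_def poly_ip_def by blast
  with \<alpha> show ?thesis unfolding verblunsky_coeffs_def by blast
qed

end


section \<open>Lebesgue decomposition\<close>

text \<open>
  \<open>lebesgue_decomposition L M Mac Msc Mpp\<close>: the measures \<open>Mac\<close>, \<open>Msc\<close>, \<open>Mpp\<close> are the absolutely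
  continuous, singular continuous and pure point parts of \<open>M\<close> with respect to \<open>L\<close>.
\<close>

definition lebesgue_decomposition ::
    "'a measure \<Rightarrow> 'a measure \<Rightarrow> 'a measure \<Rightarrow> 'a measure \<Rightarrow> 'a measure \<Rightarrow> bool" where
  "lebesgue_decomposition L M Mac Msc Mpp \<longleftrightarrow>
     sets L = sets M \<and> sets Mac = sets M \<and> sets Msc = sets M \<and> sets Mpp = sets M \<and>
     (\<forall>A\<in>sets M. emeasure M A = emeasure Mac A + emeasure Msc A + emeasure Mpp A) \<and>
     absolutely_continuous L Mac \<and>
     (\<exists>S\<in>null_sets L. emeasure Msc (space M - S) = 0) \<and>
     (\<forall>x\<in>space M. emeasure Msc {x} = 0) \<and>
     (\<exists>C\<in>sets M. countable C \<and> emeasure Mpp (space M - C) = 0)"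

text \<open>The three parts always exist for a finite measure whose singletons are measurable.\<close>

lemma lebesgue_decomposition_exists:
  fixes L M :: "'a measure"
  assumes fin: "finite_measure M" and LM: "sets L = sets M"
    and sing: "\<And>x. x \<in> space M \<Longrightarrow> {x} \<in> sets M"
  shows "\<exists>Mac Msc Mpp. lebesgue_decomposition L M Mac Msc Mpp"
proof -
  interpret finite_measure M by fact
  define P where "P = {x \<in> space M. measure M {x} \<noteq> 0}"
  have cP: "countable P"
    using countable_support unfolding P_def by (rule countable_subset[rotated]) auto
  have P: "P \<in> sets M"
  proof -
    have "P = (\<Union>x\<in>P. {x})" by auto
    also have "\<dots> \<in> sets M"
      using cP sing by (intro sets.countable_UN'') (auto simp: P_def)
    finally show ?thesis .
  qed
  define s where "s = (SUP S\<in>null_sets L. measure M S)"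
  have bdd: "bdd_above (measure M ` null_sets L)"
    by (intro bdd_aboveI[where M = "measure M (space M)"]) (auto intro: bounded_measure)
  have "\<exists>S\<in>null_sets L. s - 1 / 2 ^ n < measure M S" for n :: nat
    unfolding s_def using bdd by (intro less_cSUP_iff[THEN iffD1]) auto
  then obtain S' where S': "\<And>n::nat. S' n \<in> null_sets L" "\<And>n. s - 1 / 2 ^ n < measure M (S' n)"
    by metis
  define S where "S = (\<Union>n. S' n)"
  have S: "S \<in> null_sets L" unfolding S_def using S'(1) by auto
  then have SM: "S \<in> sets M" using LM by auto
  have "s - 1 / 2 ^ n \<le> measure M S" for n
    using S'(2)[of n] finite_measure_mono[of "S' n" S] SM by (force simp: S_def)
  moreover have "(\<lambda>n. s - 1 / 2 ^ n) \<longlonglongrightarrow> s - 0"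
    by (intro tendsto_intros LIMSEQ_divide_realpow_zero) auto
  ultimately have sS: "s \<le> measure M S"
    by (intro LIMSEQ_le_const2[where a = "measure M S"]) auto
  have null: "emeasure M (N - S) = 0" if N: "N \<in> null_sets L" for N
  proof -
    have NM: "N \<in> sets M" using N LM by auto
    have "measure M (S \<union> (N - S)) = measure M S + measure M (N - S)"
      using NM SM by (intro finite_measure_Union) auto
    moreover have "measure M (S \<union> (N - S)) \<le> s"
      unfolding s_def using null_sets.Un[OF S N] by (intro cSUP_upper bdd) simp
    ultimately have "measure M (N - S) = 0" using sS measure_nonneg[of M "N - S"] by linarith
    then show ?thesis by (simp add: emeasure_eq_measure)
  qed
  let ?D = "\<lambda>A. density M (indicator A)"
  have em: "emeasure (?D B) A = emeasure M (B \<inter> A)" if "A \<in> sets M" "B \<in> sets M" for A B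
    using that by (simp add: emeasure_restricted)
  have "lebesgue_decomposition L M (?D (space M - S - P)) (?D (S - P)) (?D P)"
    unfolding lebesgue_decomposition_def
  proof (intro conjI ballI bexI)
    fix A assume A: "A \<in> sets M"
    have "emeasure M A = emeasure M (((space M - S - P) \<inter> A \<union> (S - P) \<inter> A) \<union> P \<inter> A)"
      using sets.sets_into_space[OF A] sets.sets_into_space[OF P] by (intro arg_cong[where f = "emeasure M"]) auto
    also have "\<dots> = emeasure M ((space M - S - P) \<inter> A \<union> (S - P) \<inter> A) + emeasure M (P \<inter> A)"
      using A P SM by (intro plus_emeasure[symmetric]) auto
    also have "emeasure M ((space M - S - P) \<inter> A \<union> (S - P) \<inter> A) =
        emeasure M ((space M - S - P) \<inter> A) + emeasure M ((S - P) \<inter> A)"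
      using A P SM by (intro plus_emeasure[symmetric]) auto
    finally show "emeasure M A = emeasure (?D (space M - S - P)) A + emeasure (?D (S - P)) A + emeasure (?D P) A"
      using A P SM by (simp add: em)
  next
    show "absolutely_continuous L (?D (space M - S - P))"
      unfolding absolutely_continuous_def
    proof
      fix N assume N: "N \<in> null_sets L"
      then have NM: "N \<in> sets M" using LM by auto
      have "emeasure M ((space M - S - P) \<inter> N) \<le> emeasure M (N - S)"
        using NM SM P by (intro emeasure_mono) auto
      then show "N \<in> null_sets (?D (space M - S - P))"
        using null[OF N] NM SM P by (auto simp: null_sets_def em)
    qed
  next
    fix x assume x: "x \<in> space M"
    have "emeasure M ((S - P) \<inter> {x}) = 0"
      by (cases "x \<in> P") (use x in \<open>auto simp: P_def emeasure_eq_measure Int_insert_right\<close>)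
    then show "emeasure (?D (S - P)) {x} = 0"
      using sing[OF x] P SM by (simp add: em)
  qed (use S P SM LM cP in \<open>auto simp: em Diff_Int_distrib2 Int_Diff\<close>)
  then show ?thesis by blast
qed

end

theory Submission
  imports Defs
begin

text \<open>
  Write \<open>\<Phi>\<^sub>n\<close> for the monic orthogonal polynomials and \<open>h\<^sub>n = \<parallel>\<Phi>\<^sub>n\<parallel>\<^sup>2 = (\<Prod>j<n. 1 - \<bar>\<alpha>\<^sub>j\<bar>\<^sup>2)\<close>. The reversed
  polynomials satisfy \<open>\<parallel>\<Phi>\<^sub>n\<^sup>* - \<Phi>\<^sub>m\<^sup>*\<parallel>\<^sup>2 = h\<^sub>n - h\<^sub>m\<close> for \<open>n \<le> m\<close>, and \<open>\<bar>\<Phi>\<^sub>m\<bar>\<^sup>2 \<mu>\<close> converges weakly to a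
  multiple of Lebesgue measure. Hence on a compact Lebesgue-null set \<open>K\<close> the integral of \<open>\<bar>\<Phi>\<^sub>n\<bar>\<^sup>2\<close>
  is at most twice \<open>h\<^sub>n - lim h\<close>, which is bounded by the tail sum of \<open>\<bar>\<alpha>\<^sub>j\<bar>\<^sup>2\<close> over \<open>j \<ge> n\<close>. Along \<open>n = 2^i\<close>
  the growth assumption makes these tails geometrically small, so at almost every point of \<open>K\<close> the
  values \<open>\<Phi>\<^sub>n\<close> decay like a power of \<open>n\<close>.

  Only finitely many points \<open>z\<close> of the circle allow such a decay: with the unimodular phases
  \<open>b\<^sub>k = z\<^bsup>1-k\<^esup> \<Phi>\<^sub>k(z) / cnj (\<Phi>\<^sub>k(z))\<close> one has \<open>\<bar>\<Phi>\<^sub>k\<^sub>+\<^sub>1\<bar> = \<bar>\<Phi>\<^sub>k\<bar> \<bar>1 - \<alpha>\<^sub>k b\<^sub>k\<bar>\<close>, so decay forces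
  \<open>\<Sum>k<n. Re (\<alpha>\<^sub>k b\<^sub>k) \<ge> \<delta> log n\<close>. Since \<open>b\<^sub>k\<^sub>+\<^sub>1\<close> is close to \<open>z b\<^sub>k\<close>, the phases of distinct points are
  almost orthogonal with respect to the weights \<open>1/(k+1)\<close>, and a Bessel type inequality bounds the
  number of such points by the constant of the assumption divided by \<open>\<delta>\<^sup>2\<close>. A measure without atoms
  does not charge the remaining finite set.
\<close>

section \<open>Weighted sums of Verblunsky coefficients\<close>

lemma weighted_growth_constant_nonneg:
  fixes \<alpha> :: "nat \<Rightarrow> complex"
  assumes "(norm (\<alpha> 0))\<^sup>2 \<le> C" shows "0 \<le> C"
  using zero_le_power2 assms by (rule order_trans)

text \<open>On the block every weight is at least \<open>2^i\<close> and can be divided out.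
  Bernoulli's inequality replaces the linear factor \<open>i+2\<close> by
  \<open>2 * (3/2)^i\<close>, which leaves the geometric ratio 3/4.\<close>

lemma dyadic_block_sum_le:
  fixes \<alpha> :: "nat \<Rightarrow> complex"
  assumes D: "\<And>i. (\<Sum>k<2^i. real (k+1) * (norm (\<alpha> k))\<^sup>2) \<le> C * real (i+1)"
  shows "(\<Sum>k\<in>{2^i..<2^(Suc i)}. (norm (\<alpha> k))\<^sup>2) \<le> 2 * C * (3/4)^i"
proof -
  have "2^i * (\<Sum>k\<in>{2^i..<2^(Suc i)}. (norm (\<alpha> k))\<^sup>2)
      \<le> (\<Sum>k\<in>{2^i..<2^(Suc i)}. real (k+1) * (norm (\<alpha> k))\<^sup>2)"
    unfolding sum_distrib_left
  proof (intro sum_mono mult_right_mono)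
    fix k assume "k \<in> {2^i..<2^(Suc i)::nat}"
    then have "real (2^i) \<le> real (k+1)" by (subst of_nat_le_iff) simp
    then show "2^i \<le> real (k+1)" by simp
  qed auto
  also have "\<dots> \<le> (\<Sum>k<2^(Suc i). real (k+1) * (norm (\<alpha> k))\<^sup>2)"
    by (intro sum_mono2) auto
  also have "\<dots> \<le> C * real (i+2)" using D[of "Suc i"] by simp
  also have "\<dots> \<le> C * (2 * (3/2)^i)"
    using Bernoulli_inequality[of "1/2::real" i] weighted_growth_constant_nonneg[of \<alpha> C] D[of 0]
    by (intro mult_left_mono) auto
  also have "\<dots> = 2^i * (2 * C * (3/4)^i)"
    by (simp add: power_divide power_mult_distrib[symmetric] divide_simps)
  finally show ?thesis by simp
qed

lemma dyadic_tail_sum_le: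
  fixes \<alpha> :: "nat \<Rightarrow> complex"
  assumes D: "\<And>i. (\<Sum>k<2^i. real (k+1) * (norm (\<alpha> k))\<^sup>2) \<le> C * real (i+1)"
  shows "(\<Sum>k\<in>{2^i..<m}. (norm (\<alpha> k))\<^sup>2) \<le> 8 * C * (3/4)^i"
proof -
  have C0: "0 \<le> C" using weighted_growth_constant_nonneg[of \<alpha> C] D[of 0] by simp
  \<comment> \<open>The constant 8 makes the block bounds telescope: \<open>2 * C * (3/4)^j\<close>
    equals \<open>8 * C * ((3/4)^j - (3/4)^Suc j)\<close>.\<close>
  have block: "(\<Sum>k\<in>{2^i..<2^j}. (norm (\<alpha> k))\<^sup>2) \<le> 8 * C * ((3/4)^i - (3/4)^j)" if "i \<le> j" for j
    using that
  proof (induction j rule: dec_induct)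
    case (step j)
    have "(\<Sum>k\<in>{2^i..<2^Suc j}. (norm (\<alpha> k))\<^sup>2) =
        (\<Sum>k\<in>{2^i..<2^j}. (norm (\<alpha> k))\<^sup>2) + (\<Sum>k\<in>{2^j..<2^Suc j}. (norm (\<alpha> k))\<^sup>2)"
      using step by (intro sum.atLeastLessThan_concat[symmetric] power_increasing) auto
    also have "\<dots> \<le> 8 * C * ((3/4)^i - (3/4)^j) + 2 * C * (3/4)^j"
      using step.IH dyadic_block_sum_le[OF D, of j] by linarith
    finally show ?case by (simp add: algebra_simps)
  qed simp
  have "m \<le> 2^(m+i)" using less_exp[of "m+i"] by linarith
  then have "(\<Sum>k\<in>{2^i..<m}. (norm (\<alpha> k))\<^sup>2) \<le> (\<Sum>k\<in>{2^i..<2^(m+i)}. (norm (\<alpha> k))\<^sup>2)"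
    by (intro sum_mono2) auto
  also have "\<dots> \<le> 8 * C * ((3/4)^i - (3/4)^(m+i))" by (rule block) simp
  also have "\<dots> \<le> 8 * C * (3/4)^i" using C0 by (intro mult_left_mono) auto
  finally show ?thesis .
qed

text \<open>Each doubling of the range adds at most 1. That \<open>i\<close> has coefficient exactly
  1 fixes the diagonal term of the Bessel type inequality.\<close>

lemma harmonic_dyadic_le: "(\<Sum>k<2^i. 1 / real (k+1)) \<le> real (i+1)"
proof (induction i)
  case (Suc i)
  have "(\<Sum>k<2^Suc i. 1 / real (k+1)) =
      (\<Sum>k<2^i. 1 / real (k+1)) + (\<Sum>k\<in>{2^i..<2^Suc i}. 1 / real (k+1))"
    unfolding lessThan_atLeast0
    by (rule sum.atLeastLessThan_concat[symmetric]) simp_all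
  also have "(\<Sum>k\<in>{2^i..<2^Suc i}. 1 / real (k+1)) \<le> (\<Sum>k\<in>{2^i..<2^Suc i::nat}. 1 / 2^i)"
  proof (intro sum_mono divide_left_mono)
    fix k assume "k \<in> {2^i..<2^(Suc i)::nat}"
    then have "real (2^i) \<le> real (k+1)" by (subst of_nat_le_iff) simp
    then show "2^i \<le> real (k+1)" by simp
  qed auto
  also have "\<dots> = 1" by simp
  finally show ?case using Suc by simp
qed simp

text \<open>Abel summation: multiplying by \<open>1 - \<zeta>\<close> turns the sum into a telescoping one up to an
  error controlled by \<open>e\<close>.\<close>

lemma weighted_sum_almost_rotation_bounded:
  fixes c :: "nat \<Rightarrow> complex" and e :: "nat \<Rightarrow> real"
  assumes c: "\<And>k. norm (c k) \<le> 1" and e: "\<And>k. norm (c (Suc k) - \<zeta> * c k) \<le> e k"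
    and E: "\<And>n. (\<Sum>k<n. (e k)\<^sup>2) \<le> E" and \<zeta>: "\<zeta> \<noteq> 1"
  shows "norm (\<Sum>k<n. c k / of_nat (k+1)) \<le> (3 + E / 2) / norm (1 - \<zeta>)"
proof -
  \<comment> \<open>The summation by parts with its boundary term. The bound
    \<open>2 - 1 / real (n+1)\<close> is sharpened so that the induction telescopes.\<close>
  define T where "T n = (\<Sum>k<n. (c k - c (Suc k)) / of_nat (k+1)) + c n / of_nat (n+1)" for n
  have T: "norm (T n) \<le> 2 - 1 / real (n+1)"
  proof (induction n)
    case 0
    then show ?case using c[of 0] by (simp add: T_def)
  next
    case (Suc n)
    have "1 / real (n+1) - 1 / real (n+2) \<ge> 0" by (simp add: frac_le)
    then have "norm (c (Suc n) * of_real (1 / real (n+1) - 1 / real (n+2))) \<le> 1 / real (n+1) - 1 / real (n+2)"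
      using c[of "Suc n"] by (simp only: norm_mult norm_of_real) (simp add: mult_left_le_one_le)
    moreover have "T (Suc n) = T n - c (Suc n) * of_real (1 / real (n+1) - 1 / real (n+2))"
      by (simp add: T_def diff_divide_distrib algebra_simps)
    ultimately show ?case
      using Suc norm_triangle_ineq4[of "T n" "c (Suc n) * of_real (1 / real (n+1) - 1 / real (n+2))"]
      by simp
  qed
  have sq: "(\<Sum>k<n. 1 / (real (k+1))\<^sup>2) \<le> 2 - 2 / real (n+1)"
  proof (induction n)
    case (Suc n)
    have "1 / (real (n+1))\<^sup>2 \<le> 2 / (real (n+1) * real (n+2))"
      by (simp add: divide_simps power2_eq_square)
    also have "\<dots> = 2 * (1 / real (n+1) - 1 / real (n+2))"
      by (simp add: divide_simps)
    finally show ?case using Suc by simp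
  qed simp
  have "norm (\<Sum>k<n. (c (Suc k) - \<zeta> * c k) / of_nat (k+1)) \<le> (\<Sum>k<n. (e k)\<^sup>2 / 2 + 1 / (real (k+1))\<^sup>2 / 2)"
  proof (rule sum_norm_le)
    fix k
    have "norm ((c (Suc k) - \<zeta> * c k) / of_nat (k+1)) \<le> e k * (1 / real (k+1))"
      using e[of k] by (simp add: norm_divide divide_right_mono del: of_nat_Suc)
    \<comment> \<open>Splitting into squares is what lets the square sum bound \<open>E\<close>
      enter; the other half is the convergent sum of inverse squares.\<close>
    also have "\<dots> \<le> (e k)\<^sup>2 / 2 + (1 / real (k+1))\<^sup>2 / 2"
      using sum_squares_bound[of "e k" "1 / real (k+1)"] by simp
    finally show "norm ((c (Suc k) - \<zeta> * c k) / of_nat (k+1)) \<le> (e k)\<^sup>2 / 2 + 1 / (real (k+1))\<^sup>2 / 2"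
      by (simp add: power_divide)
  qed
  also have "\<dots> = (\<Sum>k<n. (e k)\<^sup>2) / 2 + (\<Sum>k<n. 1 / (real (k+1))\<^sup>2) / 2"
    unfolding sum.distrib sum_divide_distrib by (rule refl)
  also have "\<dots> \<le> E / 2 + 1"
  proof (intro add_mono)
    have "(\<Sum>k<n. 1 / (real (k+1))\<^sup>2) \<le> 2"
      using sq order_trans by fastforce
    then show "(\<Sum>k<n. 1 / (real (k+1))\<^sup>2) / 2 \<le> 1" by simp
  qed (use E[of n] in simp)
  finally have err: "norm (\<Sum>k<n. (c (Suc k) - \<zeta> * c k) / of_nat (k+1)) \<le> E / 2 + 1" .
  have "(1 - \<zeta>) * (\<Sum>k<n. c k / of_nat (k+1)) =
      T n - c n / of_nat (n+1) + (\<Sum>k<n. (c (Suc k) - \<zeta> * c k) / of_nat (k+1))"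
    unfolding T_def by (simp add: sum_distrib_left algebra_simps diff_divide_distrib flip: sum.distrib sum_subtractf)
  moreover have "norm (c n / of_nat (n+1)) \<le> 1 / real (n+1)"
    using c[of n] by (simp add: norm_divide divide_right_mono del: of_nat_Suc)
  \<comment> \<open>The slack \<open>1 / real (n+1)\<close> in the bound on \<open>T n\<close> pays
    for removing the boundary term, so 2 plus the error \<open>E / 2 + 1\<close> suffices.\<close>
  ultimately have "norm ((1 - \<zeta>) * (\<Sum>k<n. c k / of_nat (k+1))) \<le> 3 + E / 2"
    using T err norm_triangle_ineq[of "T n - c n / of_nat (n+1)"] norm_triangle_ineq4[of "T n" "c n / of_nat (n+1)"]
    by (smt (verit, best))
  then have "norm (\<Sum>k<n. c k / of_nat (k+1)) * norm (1 - \<zeta>) \<le> 3 + E / 2"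
    by (simp only: norm_mult mult.commute)
  moreover have "0 < norm (1 - \<zeta>)" using \<zeta> by simp
  ultimately show ?thesis by (simp only: pos_le_divide_eq)
qed

section \<open>Points of polynomial decay\<close>

text \<open>With \<open>b k = z * F k / (z^k * cnj (F k))\<close> the recursion becomes
  multiplicative: \<open>F (Suc k) = z * F k * cnj (1 - \<alpha> k * b k)\<close>. The factor cannot
  vanish because \<alpha> stays in the open disk, and one step multiplies the phase by
  \<open>z\<close> and the unimodular quotient \<open>(1 - cnj a) / (1 - a)\<close>, where
  \<open>a = \<alpha> k * b k\<close>.\<close>

lemma szego_recursion_phase:
  fixes F \<alpha> :: "nat \<Rightarrow> complex"
  assumes z: "norm z = 1" and \<alpha>: "\<And>k. norm (\<alpha> k) < 1" and F0: "F 0 \<noteq> 0"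
    and rec: "\<And>k. F (Suc k) = z * F k - cnj (\<alpha> k) * (z^k * cnj (F k))"
  obtains b where "\<And>k. norm (b k) = 1" "\<And>k. norm (b (Suc k) - z * b k) \<le> 4 * norm (\<alpha> k)"
    "\<And>k. norm (F (Suc k)) = norm (F k) * norm (1 - \<alpha> k * b k)" "\<And>k. F k \<noteq> 0"
proof -
  define b where "b k = z * F k / (z^k * cnj (F k))" for k
  have z0: "z \<noteq> 0" using z by auto
  have zc: "cnj z = 1 / z" using z by (metis complex_div_cnj divide_self_if mult_1 of_real_1 power_one nonzero_eq_divide_eq complex_norm_square z0 mult.commute)
  have nb: "norm (b k) = 1" if "F k \<noteq> 0" for k
    using that by (simp add: b_def norm_divide norm_mult norm_power z)
  have step: "F (Suc k) = z * F k * cnj (1 - \<alpha> k * b k)" if "F k \<noteq> 0" for k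
    using that z0 by (simp add: rec b_def zc power_divide field_simps)
  have ab: "norm (\<alpha> k * b k) < 1" if "F k \<noteq> 0" for k
    using nb[OF that] \<alpha>[of k] by (simp add: norm_mult)
  have F: "F k \<noteq> 0" for k
  proof (induction k)
    case (Suc k)
    then have "1 - \<alpha> k * b k \<noteq> 0" using ab[of k] by auto
    then have "cnj (1 - \<alpha> k * b k) \<noteq> 0" using complex_cnj_zero_iff by blast
    then show ?case using step[OF Suc] Suc z0 by simp
  qed (rule F0)
  have nF: "norm (F (Suc k)) = norm (F k) * norm (1 - \<alpha> k * b k)" for k
    unfolding step[OF F] norm_mult complex_mod_cnj z by simp
  have db: "norm (b (Suc k) - z * b k) \<le> 4 * norm (\<alpha> k)" for k
  proof -
    define a where "a = \<alpha> k * b k"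
    have na: "norm a = norm (\<alpha> k)" using nb[OF F] by (simp add: a_def norm_mult)
    have a1: "1 - a \<noteq> 0" "1 - cnj a \<noteq> 0"
      using ab[OF F, of k] unfolding a_def[symmetric] by (metis complex_cnj_one complex_cnj_cnj eq_iff_diff_eq_0 less_irrefl norm_one)+
    have eq: "b (Suc k) = z * b k * ((1 - cnj a) / (1 - a))"
    proof -
      have "b (Suc k) = z * (z * F k * (1 - cnj a)) / (z * z^k * (cnj z * cnj (F k) * (1 - a)))"
        unfolding b_def[of "Suc k"] step[OF F] a_def by simp
      also have "\<dots> = z * b k * ((1 - cnj a) / (1 - a))"
        unfolding b_def zc using F[of k] z0 a1 by (simp add: field_simps)
      finally show ?thesis .
    qed
    have "norm (b (Suc k) - z * b k) = norm ((1 - cnj a) / (1 - a) - 1)"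
    proof -
      have "b (Suc k) - z * b k = z * b k * ((1 - cnj a) / (1 - a) - 1)" unfolding eq by (simp add: algebra_simps)
      then show ?thesis using nb[OF F] z by (simp add: norm_mult)
    qed
    also have "\<dots> \<le> 4 * norm a"
    \<comment> \<open>For small \<open>a\<close> the denominator is at least 1/2; for large
      \<open>a\<close> the trivial bound 2 for the distance of two unimodular numbers is already
      below \<open>4 * norm a\<close>.\<close>
    proof (cases "norm a \<le> 1/2")
      case True
      have "(1 - cnj a) / (1 - a) - 1 = (a - cnj a) / (1 - a)" using a1 by (simp add: field_simps)
      then have "norm ((1 - cnj a) / (1 - a) - 1) = norm (a - cnj a) / norm (1 - a)"
        by (simp add: norm_divide)
      also have "\<dots> \<le> (2 * norm a) / (1/2)"
      proof (intro frac_le)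
        show "norm (a - cnj a) \<le> 2 * norm a" using norm_triangle_ineq4[of a "cnj a"] by simp
        show "1/2 \<le> norm (1 - a)" using True norm_triangle_ineq2[of 1 a] by simp
      qed auto
      finally show ?thesis by simp
    next
      case False
      have "norm ((1 - cnj a) / (1 - a)) = norm (cnj (1 - a)) / norm (1 - a)" by (simp add: norm_divide)
      also have "\<dots> = 1" using a1 unfolding complex_mod_cnj by simp
      finally have "norm ((1 - cnj a) / (1 - a) - 1) \<le> 2"
        using norm_triangle_ineq4[of "(1 - cnj a) / (1 - a)" 1] by simp
      then show ?thesis using False by simp
    qed
    finally show ?thesis using na by simp
  qed
  show thesis by (rule that[of b]) (use nb F nF db in auto)
qed

text \<open>Second order expansion of the logarithm at \<open>1 + t\<close>, where
  \<open>t = (norm a)\<^sup>2 - 2 * Re a\<close>. The threshold 1/6 gives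
  \<open>\<bar>t\<bar> \<le> 3 * norm a \<le> 1/2\<close>, the range of the logarithm bound, and 18
  is twice the square of 3.\<close>

lemma ln_norm_one_minus_ge:
  fixes a :: complex
  assumes "norm a \<le> 1/6"
  shows "ln ((norm (1 - a))\<^sup>2) \<ge> - 2 * Re a - 18 * (norm a)\<^sup>2"
proof -
  define t where "t = (norm a)\<^sup>2 - 2 * Re a"
  have t: "(norm (1 - a))\<^sup>2 = 1 + t"
    unfolding t_def cmod_power2 by (simp add: power2_eq_square algebra_simps)
  have "\<bar>t\<bar> \<le> (norm a)\<^sup>2 + 2 * norm a"
    using abs_Re_le_cmod[of a] zero_le_power2[of "norm a"] unfolding t_def abs_le_iff by linarith
  also have "(norm a)\<^sup>2 \<le> norm a"
    using assms by (simp add: power2_eq_square mult_left_le)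
  finally have t3: "\<bar>t\<bar> \<le> 3 * norm a" by simp
  then have "\<bar>ln (1 + t) - t\<bar> \<le> 2 * t\<^sup>2"
    using assms by (intro abs_ln_one_plus_x_minus_x_bound) simp
  moreover have "t\<^sup>2 \<le> (3 * norm a)\<^sup>2"
    using power_mono[OF t3 abs_ge_zero, of 2] by simp
  ultimately have "ln (1 + t) \<ge> t - 18 * (norm a)\<^sup>2" by (simp add: power_mult_distrib abs_le_iff)
  then show ?thesis unfolding t unfolding t_def using zero_le_power2[of "norm a"] by linarith
qed

lemma bdd_below_eventually_incseq:
  fixes g :: "nat \<Rightarrow> real"
  assumes "\<And>n. n \<ge> k \<Longrightarrow> g n \<le> g (Suc n)"
  obtains m where "\<And>n. m \<le> g n"
proof -
  have up: "g k \<le> g n" if "k \<le> n" for n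
    using that by (induction n rule: dec_induct) (auto intro: order_trans assms)
  have "Min (g ` {..k}) \<le> g n" for n
  proof (cases "n \<le> k")
    case False
    have "Min (g ` {..k}) \<le> g k" by simp
    also have "\<dots> \<le> g n" using up[of n] False by simp
    finally show ?thesis .
  qed auto
  then show thesis by (rule that)
qed

text \<open>The function \<open>g\<close> adds to \<open>ln ((norm (F n))\<^sup>2)\<close> the first
  order terms and enough second order terms to be nondecreasing once the coefficients are below 1/6.
  Hence \<open>g\<close> is bounded below, and a logarithm that falls linearly in \<open>i\<close>
  must be compensated by the phase sum.\<close>

lemma phase_sum_ge_of_decay:
  fixes F \<alpha> b :: "nat \<Rightarrow> complex"
  assumes F: "\<And>k. F k \<noteq> 0" and b: "\<And>k. norm (b k) = 1"
    and step: "\<And>k. norm (F (Suc k)) = norm (F k) * norm (1 - \<alpha> k * b k)"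
    and B: "\<And>n. (\<Sum>k<n. (norm (\<alpha> k))\<^sup>2) \<le> B"
    and C: "\<And>i. (norm (F (2^i)))\<^sup>2 \<le> C * q^i" and q: "0 < q"
  obtains C' where "\<And>i. (\<Sum>k<2^i. Re (\<alpha> k * b k)) \<ge> ln (1/q) / 2 * real i - C'"
proof -
  define g where "g n = ln ((norm (F n))\<^sup>2) + 2 * (\<Sum>k<n. Re (\<alpha> k * b k)) + 18 * (\<Sum>k<n. (norm (\<alpha> k))\<^sup>2)" for n
  have "summable (\<lambda>k. (norm (\<alpha> k))\<^sup>2)"
    by (rule summableI_nonneg_bounded[OF _ B]) simp
  then have "(\<lambda>k. (norm (\<alpha> k))\<^sup>2) \<longlonglongrightarrow> 0" by (rule summable_LIMSEQ_zero)
  then have "\<forall>\<^sub>F k in sequentially. (norm (\<alpha> k))\<^sup>2 < (1/6)\<^sup>2"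
    by (rule order_tendstoD) (simp add: power_divide)
  then obtain k0 where k0: "\<And>k. k \<ge> k0 \<Longrightarrow> (norm (\<alpha> k))\<^sup>2 < (1/6)\<^sup>2"
    unfolding eventually_sequentially by blast
  have "g n \<le> g (Suc n)" if "n \<ge> k0" for n
  proof -
    have na: "norm (\<alpha> n * b n) = norm (\<alpha> n)" using b by (simp add: norm_mult)
    have "norm (\<alpha> n) < 1/6" using k0[OF that] by (rule power2_less_imp_less) simp
    then have l: "ln ((norm (1 - \<alpha> n * b n))\<^sup>2) \<ge> - 2 * Re (\<alpha> n * b n) - 18 * (norm (\<alpha> n))\<^sup>2"
      using ln_norm_one_minus_ge[of "\<alpha> n * b n"] na by simp
    have "1 - \<alpha> n * b n \<noteq> 0" using step[of n] F[of n] F[of "Suc n"] by auto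
    then have "ln ((norm (F (Suc n)))\<^sup>2) = ln ((norm (F n))\<^sup>2) + ln ((norm (1 - \<alpha> n * b n))\<^sup>2)"
      unfolding step power_mult_distrib using F[of n] by (subst ln_mult) auto
    then show ?thesis using l unfolding g_def by simp
  qed
  then obtain m where m: "\<And>n. m \<le> g n" by (rule bdd_below_eventually_incseq) auto
  have "(norm (F (2^0)))\<^sup>2 > 0" using F[of "2^0"] by simp
  then have Cpos: "C > 0" using C[of 0] unfolding power_0 mult_1_right by (rule less_le_trans)
  show thesis
  proof (rule that[of "(ln C + 18 * B - m) / 2"])
    fix i :: nat
    have "ln ((norm (F (2^i)))\<^sup>2) \<le> ln (C * q^i)"
      using C[of i] F[of "2^i"] Cpos q by (subst ln_le_cancel_iff) auto
    also have "\<dots> = ln C - real i * ln (1/q)"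
      using Cpos q by (simp add: ln_mult ln_realpow ln_div)
    finally show "(\<Sum>k<2^i. Re (\<alpha> k * b k)) \<ge> ln (1/q) / 2 * real i - (ln C + 18 * B - m) / 2"
      using m[of "2^i"] B[of "2^i"] unfolding g_def by (simp add: field_simps)
  qed
qed


text \<open>Summed over \<open>X\<close>, the growth bounds \<open>card X * \<delta> * i\<close>, up
  to a constant, by the sum of \<open>Re (\<alpha> k * S k)\<close> with \<open>S k\<close> the sum
  of the phases. Weighted arithmetic-geometric means bound the latter by
  \<open>C * i / (2 * \<delta>) + \<delta> * card X * i / 2\<close> plus a constant, because
  products of phases of distinct points have bounded weighted sums. Comparing the coefficients of
  \<open>i\<close> gives the bound on \<open>card X\<close>.\<close>

lemma finite_phase_sum_growth:
  fixes \<alpha> :: "nat \<Rightarrow> complex" and b :: "complex \<Rightarrow> nat \<Rightarrow> complex"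
  assumes D: "\<And>i. (\<Sum>k<2^i. real (k+1) * (norm (\<alpha> k))\<^sup>2) \<le> C * real (i+1)"
    and B: "\<And>n. (\<Sum>k<n. (norm (\<alpha> k))\<^sup>2) \<le> B"
    and X: "finite X" "\<And>x. x \<in> X \<Longrightarrow> norm x = 1"
    and b: "\<And>x k. x \<in> X \<Longrightarrow> norm (b x k) = 1"
    and step: "\<And>x k. x \<in> X \<Longrightarrow> norm (b x (Suc k) - x * b x k) \<le> 4 * norm (\<alpha> k)"
    and growth: "\<And>x i. x \<in> X \<Longrightarrow> (\<Sum>k<2^i. Re (\<alpha> k * b x k)) \<ge> \<delta> * real i - c x"
    and \<delta>: "\<delta> > 0"
  shows "real (card X) \<le> C / \<delta>\<^sup>2"
proof -
  define S where "S k = (\<Sum>x\<in>X. b x k)" for k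
  \<comment> \<open>The part of each Gram entry that stays bounded in \<open>i\<close>. Off the
    diagonal the product of phases rotates by \<open>x * cnj y\<close> with error
    \<open>8 * norm (\<alpha> k)\<close>, whose squares sum to at most
    \<open>64 * B\<close>.\<close>
  define H where "H x y = (if x = y then 1 else (3 + 64 * B / 2) / norm (1 - x * cnj y))" for x y :: complex
  have G: "Re (\<Sum>k<2^i. b x k * cnj (b y k) / of_nat (k+1)) \<le> (if x = y then real i else 0) + H x y"
    if "x \<in> X" "y \<in> X" for x y i
  proof (cases "x = y")
    case True
    have "b x k * cnj (b x k) = 1" for k
      using b[OF that(1), of k] by (metis complex_norm_square of_real_1 power_one)
    then have "(\<Sum>k<2^i. b x k * cnj (b y k) / of_nat (k+1)) = of_real (\<Sum>k<2^i. 1 / real (k+1))"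
      using True by simp
    then show ?thesis using True harmonic_dyadic_le[of i] by (simp add: H_def)
  next
    case False
    have yy: "y * cnj y = 1" using X(2)[OF that(2)] by (metis complex_norm_square of_real_1 power_one)
    have "x * cnj y \<noteq> 1"
    proof
      assume "x * cnj y = 1"
      then have "x * (y * cnj y) = y" by (simp add: mult.left_commute)
      then show False using yy False by simp
    qed
    moreover have "norm (b x (Suc k) * cnj (b y (Suc k)) - x * cnj y * (b x k * cnj (b y k))) \<le> 8 * norm (\<alpha> k)" for k
    proof -
      have "b x (Suc k) * cnj (b y (Suc k)) - x * cnj y * (b x k * cnj (b y k)) =
          (b x (Suc k) - x * b x k) * cnj (b y (Suc k)) + x * b x k * cnj (b y (Suc k) - y * b y k)"
        by (simp add: algebra_simps)
      also have "norm \<dots> \<le> norm ((b x (Suc k) - x * b x k) * cnj (b y (Suc k)))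
          + norm (x * b x k * cnj (b y (Suc k) - y * b y k))" by (rule norm_triangle_ineq)
      also have "\<dots> = norm (b x (Suc k) - x * b x k) + norm (b y (Suc k) - y * b y k)"
        unfolding norm_mult complex_mod_cnj by (simp add: b that X)
      also have "\<dots> \<le> 8 * norm (\<alpha> k)" using step[OF that(1), of k] step[OF that(2), of k] by simp
      finally show ?thesis .
    qed
    moreover have "(\<Sum>k<n. (8 * norm (\<alpha> k))\<^sup>2) \<le> 64 * B" for n
      using B[of n] by (simp add: power_mult_distrib flip: sum_distrib_left)
    ultimately have "norm (\<Sum>k<2^i. b x k * cnj (b y k) / of_nat (k+1)) \<le> (3 + 64 * B / 2) / norm (1 - x * cnj y)"
      by (intro weighted_sum_almost_rotation_bounded[where e = "\<lambda>k. 8 * norm (\<alpha> k)"])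
         (auto simp: norm_mult b that)
    from order_trans[OF complex_Re_le_cmod this] show ?thesis
      unfolding H_def using False by (simp only: if_False add_0)
  qed
  have S2: "(\<Sum>k<2^i. (norm (S k))\<^sup>2 / real (k+1)) \<le> real (card X) * real i + (\<Sum>x\<in>X. \<Sum>y\<in>X. H x y)" for i
  proof -
    have "of_real ((norm (S k))\<^sup>2 / real (k+1)) = (\<Sum>x\<in>X. \<Sum>y\<in>X. b x k * cnj (b y k) / of_nat (k+1))" for k
    proof -
      have "complex_of_real ((norm (S k))\<^sup>2) = (\<Sum>x\<in>X. \<Sum>y\<in>X. b x k * cnj (b y k))"
        unfolding complex_norm_square S_def cnj_sum sum_product ..
      then show ?thesis by (simp add: sum_divide_distrib)
    qed
    then have "of_real (\<Sum>k<2^i. (norm (S k))\<^sup>2 / real (k+1)) = (\<Sum>k<2^i. \<Sum>x\<in>X. \<Sum>y\<in>X. b x k * cnj (b y k) / of_nat (k+1))"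
      by (simp only: of_real_sum)
    also have "\<dots> = (\<Sum>x\<in>X. \<Sum>y\<in>X. \<Sum>k<2^i. b x k * cnj (b y k) / of_nat (k+1))"
      by (subst sum.swap, intro sum.cong refl, rule sum.swap)
    finally have "(\<Sum>k<2^i. (norm (S k))\<^sup>2 / real (k+1)) = Re (\<Sum>x\<in>X. \<Sum>y\<in>X. \<Sum>k<2^i. b x k * cnj (b y k) / of_nat (k+1))"
      by (metis Re_complex_of_real)
    also have "\<dots> = (\<Sum>x\<in>X. \<Sum>y\<in>X. Re (\<Sum>k<2^i. b x k * cnj (b y k) / of_nat (k+1)))"
      unfolding Re_sum ..
    also have "\<dots> \<le> (\<Sum>x\<in>X. \<Sum>y\<in>X. (if x = y then real i else 0) + H x y)"
      by (intro sum_mono G)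
    also have "\<dots> = real (card X) * real i + (\<Sum>x\<in>X. \<Sum>y\<in>X. H x y)"
      using X(1) by (simp add: sum.distrib sum.delta)
    finally show ?thesis .
  qed
  define K where "K = C / (2 * \<delta>) + \<delta> / 2 * (\<Sum>x\<in>X. \<Sum>y\<in>X. H x y) + (\<Sum>x\<in>X. c x)"
  have main: "real i * (real (card X) * \<delta> / 2 - C / (2 * \<delta>)) \<le> K" for i
  proof -
    have "real (card X) * \<delta> * real i - (\<Sum>x\<in>X. c x) = (\<Sum>x\<in>X. \<delta> * real i - c x)"
      by (simp add: sum_subtractf)
    also have "\<dots> \<le> (\<Sum>x\<in>X. \<Sum>k<2^i. Re (\<alpha> k * b x k))"
      by (intro sum_mono growth)
    also have "\<dots> = (\<Sum>k<2^i. \<Sum>x\<in>X. Re (\<alpha> k * b x k))" by (rule sum.swap)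
    also have "\<dots> = (\<Sum>k<2^i. Re (\<alpha> k * S k))"
      unfolding S_def sum_distrib_left Re_sum ..
    also have "\<dots> \<le> (\<Sum>k<2^i. 1 / (2 * \<delta>) * (real (k+1) * (norm (\<alpha> k))\<^sup>2) + \<delta> / 2 * ((norm (S k))\<^sup>2 / real (k+1)))"
    proof (rule sum_mono)
      fix k
      \<comment> \<open>The factor \<open>r\<close> produces the weights \<open>k+1\<close> and
        \<open>1/(k+1)\<close>; the factor \<open>s\<close> balances the two squares so that the
        leading terms match with the constant \<open>\<delta>\<close>.\<close>
      define r where "r = sqrt (real (k+1))"
      define s where "s = sqrt \<delta>"
      have rs: "r > 0" "s > 0" "r\<^sup>2 = real (k+1)" "s\<^sup>2 = \<delta>" using \<delta> by (auto simp: r_def s_def)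
      have amgm: "x * y \<le> (x\<^sup>2 + y\<^sup>2) / 2" for x y :: real
        using sum_squares_bound[of x y] by simp
      have "Re (\<alpha> k * S k) \<le> (norm (\<alpha> k) * r / s) * (norm (S k) * s / r)"
        using complex_Re_le_cmod[of "\<alpha> k * S k"] rs by (simp add: norm_mult)
      also have "\<dots> \<le> ((norm (\<alpha> k) * r / s)\<^sup>2 + (norm (S k) * s / r)\<^sup>2) / 2"
        by (rule amgm)
      also have "\<dots> = 1 / (2 * \<delta>) * (real (k+1) * (norm (\<alpha> k))\<^sup>2) + \<delta> / 2 * ((norm (S k))\<^sup>2 / real (k+1))"
        unfolding power_divide power_mult_distrib rs(3,4) by (simp add: add_divide_distrib mult_ac)
      finally show "Re (\<alpha> k * S k) \<le> \<dots>" .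
    qed
    also have "\<dots> = 1 / (2 * \<delta>) * (\<Sum>k<2^i. real (k+1) * (norm (\<alpha> k))\<^sup>2) + \<delta> / 2 * (\<Sum>k<2^i. (norm (S k))\<^sup>2 / real (k+1))"
      unfolding sum.distrib sum_distrib_left ..
    also have "\<dots> \<le> 1 / (2 * \<delta>) * (C * real (i+1)) + \<delta> / 2 * (real (card X) * real i + (\<Sum>x\<in>X. \<Sum>y\<in>X. H x y))"
      using \<delta> by (intro add_mono mult_left_mono D S2) auto
    finally have "real (card X) * \<delta> * real i - (\<Sum>x\<in>X. c x) \<le> \<dots>" .
    moreover have "\<dots> = real i * (C / (2 * \<delta>)) + real i * (real (card X) * \<delta> / 2) + (K - (\<Sum>x\<in>X. c x))"
      by (simp add: K_def algebra_simps add_divide_distrib)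
    ultimately show ?thesis by (simp add: algebra_simps)
  qed
  \<comment> \<open>A positive slope would exceed the constant \<open>K\<close> for large
    \<open>i\<close>.\<close>
  have "real (card X) * \<delta> / 2 - C / (2 * \<delta>) \<le> 0"
  proof (rule ccontr)
    assume "\<not> real (card X) * \<delta> / 2 - C / (2 * \<delta>) \<le> 0"
    then obtain i where "K < real i * (real (card X) * \<delta> / 2 - C / (2 * \<delta>))"
      using reals_Archimedean3 by (meson not_le)
    with main[of i] show False by simp
  qed
  then show ?thesis using \<delta> by (simp add: field_simps power2_eq_square)
qed

text \<open>An infinite set would contain a finite subset with more than
  \<open>C / \<delta>\<^sup>2\<close> points, where \<delta> is half of \<open>ln (1/q)\<close>;
  each point supplies phases whose sums grow with this \<delta>, against the cardinality
  bound.\<close>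

lemma finite_decaying_points:
  fixes \<alpha> :: "nat \<Rightarrow> complex" and F :: "complex \<Rightarrow> nat \<Rightarrow> complex"
  assumes D: "\<And>i. (\<Sum>k<2^i. real (k+1) * (norm (\<alpha> k))\<^sup>2) \<le> C * real (i+1)"
    and \<alpha>: "\<And>k. norm (\<alpha> k) < 1" and F0: "\<And>z. F z 0 = 1"
    and rec: "\<And>z k. norm z = 1 \<Longrightarrow> F z (Suc k) = z * F z k - cnj (\<alpha> k) * (z^k * cnj (F z k))"
    and q: "0 < q" "q < 1"
  shows "finite {z. norm z = 1 \<and> (\<exists>c. \<forall>i. (norm (F z (2^i)))\<^sup>2 \<le> c * q^i)}" (is "finite ?Z")
proof (rule ccontr)
  define \<delta> where "\<delta> = ln (1/q) / 2"
  have \<delta>: "\<delta> > 0" using q by (simp add: \<delta>_def)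
  \<comment> \<open>The 1 covers the coefficient with index 0; the remaining ones form the dyadic
    tail that starts at \<open>2^0\<close>.\<close>
  define B where "B = 1 + 8 * C"
  have B: "(\<Sum>k<n. (norm (\<alpha> k))\<^sup>2) \<le> B" for n
  proof -
    have "(\<Sum>k<n. (norm (\<alpha> k))\<^sup>2) \<le> (\<Sum>k<Suc n. (norm (\<alpha> k))\<^sup>2)" by simp
    also have "\<dots> = (norm (\<alpha> 0))\<^sup>2 + (\<Sum>k\<in>{2^0..<Suc n}. (norm (\<alpha> k))\<^sup>2)"
      unfolding lessThan_atLeast0 by (subst sum.atLeast_Suc_lessThan) auto
    also have "\<dots> \<le> 1 + 8 * C * (3/4)^0"
      using \<alpha>[of 0] by (intro add_mono dyadic_tail_sum_le[OF D]) (simp add: power_le_one)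
    finally show ?thesis by (simp add: B_def)
  qed
  assume "infinite ?Z"
  then obtain X where X: "finite X" "card X = Suc (nat \<lceil>C / \<delta>\<^sup>2\<rceil>)" "X \<subseteq> ?Z"
    using infinite_arbitrarily_large[of ?Z "Suc (nat \<lceil>C / \<delta>\<^sup>2\<rceil>)"] by blast
  define Q where "Q x b c \<longleftrightarrow> (\<forall>k. norm (b k) = 1) \<and> (\<forall>k. norm (b (Suc k) - x * b k) \<le> 4 * norm (\<alpha> k)) \<and>
      (\<forall>i. (\<Sum>k<2^i. Re (\<alpha> k * b k)) \<ge> \<delta> * real i - c)" for x b c
  have "\<exists>b c. Q x b c" if "x \<in> X" for x
  proof -
    have x: "norm x = 1" and "\<exists>c. \<forall>i. (norm (F x (2^i)))\<^sup>2 \<le> c * q^i" using X(3) that by auto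
    then obtain c where c: "\<And>i. (norm (F x (2^i)))\<^sup>2 \<le> c * q^i" by blast
    have "F x 0 \<noteq> 0" by (simp add: F0)
    from szego_recursion_phase[of x \<alpha> "F x", OF x \<alpha> this rec[OF x]]
    obtain b where b: "\<And>k. norm (b k) = 1" "\<And>k. norm (b (Suc k) - x * b k) \<le> 4 * norm (\<alpha> k)"
      "\<And>k. norm (F x (Suc k)) = norm (F x k) * norm (1 - \<alpha> k * b k)" "\<And>k. F x k \<noteq> 0" by blast
    from phase_sum_ge_of_decay[of "F x" b \<alpha> B c q, OF b(4,1,3) B c q(1)]
    obtain c' where "\<And>i. (\<Sum>k<2^i. Re (\<alpha> k * b k)) \<ge> \<delta> * real i - c'"
      unfolding \<delta>_def by blast
    then have "Q x b c'" unfolding Q_def using b(1,2) by simp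
    then show ?thesis by blast
  qed
  then obtain b c where bc: "\<And>x. x \<in> X \<Longrightarrow> Q x (b x) (c x)" by metis
  have "real (card X) \<le> C / \<delta>\<^sup>2"
    by (rule finite_phase_sum_growth[OF D B X(1) _ _ _ _ \<delta>, of b c]) (use bc X(3) in \<open>auto simp: Q_def\<close>)
  then show False using X(2) by linarith
qed

section \<open>Orthogonal polynomials on the circle\<close>

locale circle_orthogonal_polys =
  fixes M :: "complex measure" and \<Phi> :: "nat \<Rightarrow> complex poly" and \<alpha> :: "nat \<Rightarrow> complex"
  assumes prob: "prob_space M" and sets_M: "sets M = sets circle_borel"
    and not_finite: "\<not> finitely_supported M"
    and orthogonal: "monic_orthogonal_polys M \<Phi>"
    and recursion: "\<And>n. \<Phi> (Suc n) = [:0, 1:] * \<Phi> n - smult (cnj (\<alpha> n)) (reversed_poly (\<Phi> n))"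
begin

sublocale prob_space M by (rule prob)

abbreviation ip where "ip \<equiv> poly_ip M"
abbreviation \<Phi>s where "\<Phi>s n \<equiv> reversed_poly (\<Phi> n)"
definition h where "h n = (LINT z|M. (norm (poly (\<Phi> n) z))\<^sup>2)"

lemmas ip_def = poly_ip_def[OF prob sets_M not_finite]
lemmas space_M = space_circle_measure[OF prob sets_M not_finite]
lemmas integrable_continuous = integrable_circle_continuous[OF prob sets_M not_finite]
lemmas integrable_ip = integrable_poly_prod[OF prob sets_M not_finite]
lemmas poly_reversed_circle = poly_reversed_poly_circle[OF prob sets_M not_finite]

lemma norm_M: "z \<in> space M \<Longrightarrow> norm z = 1"
  by (simp add: space_M)

lemma mult_cnj_circle: "norm z = 1 \<Longrightarrow> z * cnj z = (1::complex)"
  by (metis complex_norm_square of_real_1 power_one)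

section \<open>Calculus of the inner product\<close>

lemma ip_cong:
  "(\<And>z. norm z = 1 \<Longrightarrow> poly p z * cnj (poly q z) = poly p' z * cnj (poly q' z)) \<Longrightarrow> ip p q = ip p' q'"
  unfolding ip_def by (intro Bochner_Integration.integral_cong refl) (simp add: norm_M)

lemma ip_cnj: "ip p q = cnj (ip q p)"
  unfolding ip_def by (subst Bochner_Integration.integral_cnj[symmetric]) (simp add: mult.commute del: Bochner_Integration.integral_cnj)

lemma ip_add_left: "ip (p + r) q = ip p q + ip r q"
  unfolding ip_def by (subst Bochner_Integration.integral_add[symmetric]) (auto intro: integrable_ip simp: algebra_simps)

lemma ip_diff_left: "ip (p - r) q = ip p q - ip r q"
  unfolding ip_def by (subst Bochner_Integration.integral_diff[symmetric]) (auto intro: integrable_ip simp: algebra_simps)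

lemma ip_smult_left: "ip (smult c p) q = c * ip p q"
  unfolding ip_def by (subst integral_mult_right_zero[symmetric]) (simp add: mult.assoc)

lemma ip_add_right: "ip q (p + r) = ip q p + ip q r"
  by (subst (1 2 3) ip_cnj) (simp add: ip_add_left)

lemma ip_diff_right: "ip q (p - r) = ip q p - ip q r"
  by (subst (1 2 3) ip_cnj) (simp add: ip_diff_left)

lemma ip_smult_right: "ip q (smult c p) = cnj c * ip q p"
  by (subst (1 2) ip_cnj) (simp add: ip_smult_left)

lemma ip_self: "ip p p = of_real (LINT z|M. (norm (poly p z))\<^sup>2)"
  unfolding ip_def by (simp only: complex_norm_square[symmetric] integral_complex_of_real)

lemma integrable_norm_power2: "integrable M (\<lambda>z. (norm (poly p z))\<^sup>2)"
  using integrable_ip[of p p] by (simp only: complex_norm_square[symmetric] complex_of_real_integrable_eq)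

text \<open>Cauchy-Schwarz in additive form; the free parameter \<open>t\<close> replaces the
  optimisation and avoids square roots of the norms.\<close>

lemma norm_ip_le:
  assumes t: "t > 0"
  shows "norm (ip p q) \<le> (t * Re (ip p p) + Re (ip q q) / t) / 2"
proof -
  have int: "integrable M (\<lambda>z. (t * (norm (poly p z))\<^sup>2 + (norm (poly q z))\<^sup>2 / t) / 2)"
    by (intro integrable_divide Bochner_Integration.integrable_add integrable_mult_right integrable_norm_power2)
  have "norm (ip p q) \<le> (LINT z|M. norm (poly p z * cnj (poly q z)))"
    unfolding ip_def by (rule integral_norm_bound)
  also have "\<dots> \<le> (LINT z|M. (t * (norm (poly p z))\<^sup>2 + (norm (poly q z))\<^sup>2 / t) / 2)"
  proof (rule integral_mono[OF integrable_norm[OF integrable_ip] int])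
    fix z
    define s where "s = sqrt t"
    have s: "s > 0" "t = s\<^sup>2" using t by (auto simp: s_def)
    show "norm (poly p z * cnj (poly q z)) \<le> (t * (norm (poly p z))\<^sup>2 + (norm (poly q z))\<^sup>2 / t) / 2"
      using sum_squares_bound[of "s * norm (poly p z)" "norm (poly q z) / s"] s(1)
      unfolding s(2) by (simp add: norm_mult power_mult_distrib power_divide)
  qed
  also have "\<dots> = (t * Re (ip p p) + Re (ip q q) / t) / 2"
    unfolding ip_self using integrable_norm_power2[of p] integrable_norm_power2[of q]
    by simp
  finally show ?thesis .
qed

section \<open>Orthogonality relations of the polynomials and their reversals\<close>

lemma degree_\<Phi>: "degree (\<Phi> n) = n" and lead_coeff_\<Phi>: "coeff (\<Phi> n) n = 1"
  using orthogonal unfolding monic_orthogonal_polys_def by metis+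

lemma ip_\<Phi>: "m \<noteq> n \<Longrightarrow> ip (\<Phi> m) (\<Phi> n) = 0"
  using orthogonal unfolding monic_orthogonal_polys_def ip_def by blast

lemma ip_\<Phi>_self: "ip (\<Phi> n) (\<Phi> n) = of_real (h n)"
  by (simp add: ip_self h_def)

text \<open>Monicity makes the system triangular: by induction only the top monomial of
  \<open>\<Phi> k\<close> survives in \<open>ip (\<Phi> n) (\<Phi> k)\<close>.\<close>

lemma ip_\<Phi>_monom: "k < n \<Longrightarrow> ip (\<Phi> n) (monom 1 k) = 0"
proof (induction k rule: less_induct)
  case (less k)
  have "ip (\<Phi> n) (\<Phi> k) = cnj (coeff (\<Phi> k) k) * ip (\<Phi> n) (monom 1 k)"
    using less by (intro poly_ip_orth[OF prob sets_M not_finite]) (auto simp: degree_\<Phi>)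
  then show ?case using ip_\<Phi>[of n k] less.prems by (simp add: lead_coeff_\<Phi>)
qed

lemma ip_\<Phi>_low_degree: "degree q \<le> n \<Longrightarrow> ip (\<Phi> n) q = cnj (coeff q n) * of_real (h n)"
  using poly_ip_orth[OF prob sets_M not_finite, of n "\<Phi> n" q] poly_ip_orth[OF prob sets_M not_finite, of n "\<Phi> n" "\<Phi> n"]
  by (simp add: ip_\<Phi>_monom degree_\<Phi> lead_coeff_\<Phi> ip_\<Phi>_self)

lemma degree_reversed: "degree (\<Phi>s n) \<le> n"
  using degree_reflect_poly_le[of "map_poly cnj (\<Phi> n)"] by (simp add: reversed_poly_def degree_map_poly degree_\<Phi>)

lemma coeff_0_reversed: "coeff (\<Phi>s n) 0 = 1"
  by (simp add: reversed_poly_def degree_map_poly coeff_map_poly degree_\<Phi> lead_coeff_\<Phi>)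

lemma norm_reversed: "norm z = 1 \<Longrightarrow> norm (poly (\<Phi>s n) z) = norm (poly (\<Phi> n) z)"
  by (simp add: poly_reversed_circle norm_mult norm_power)

lemma ip_reversed_self: "ip (\<Phi>s n) (\<Phi>s n) = of_real (h n)"
  unfolding ip_self h_def by (intro arg_cong[where f = of_real] Bochner_Integration.integral_cong refl) (simp add: norm_reversed norm_M)

lemma ip_reversed_monom:
  assumes "k \<le> n" shows "ip (\<Phi>s n) (monom 1 k) = cnj (ip (\<Phi> n) (monom 1 (n - k)))"
proof -
  have "ip (\<Phi>s n) (monom 1 k) = ip (monom 1 (n - k)) (\<Phi> n)"
  proof (rule ip_cong)
    fix z :: complex assume z: "norm z = 1"
    have "z ^ n * cnj z ^ k = z ^ (n - k) * (z * cnj z) ^ k"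
      using assms by (simp add: power_mult_distrib flip: power_add)
    then show "poly (\<Phi>s n) z * cnj (poly (monom 1 k) z) = poly (monom 1 (n - k)) z * cnj (poly (\<Phi> n) z)"
      unfolding mult_cnj_circle[OF z] by (simp add: poly_reversed_circle[OF z] degree_\<Phi> poly_monom mult_ac)
  qed
  then show ?thesis by (metis ip_cnj)
qed

text \<open>Reversal exchanges the monomials \<open>k\<close> and \<open>n - k\<close>, so
  \<open>\<Phi>s n\<close> is orthogonal to all of them from 1 to \<open>n\<close>. Up to the factor
  \<open>h n\<close> it reproduces the value at 0.\<close>

lemma ip_reversed_low_degree:
  assumes "degree q \<le> n" shows "ip (\<Phi>s n) q = cnj (coeff q 0) * of_real (h n)"
proof -
  have "q = (\<Sum>k\<le>n. smult (coeff q k) (monom 1 k))"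
    using poly_as_sum_of_monoms'[OF assms] by (simp add: smult_monom)
  then have "ip (\<Phi>s n) q = (\<Sum>k\<le>n. cnj (coeff q k) * ip (\<Phi>s n) (monom 1 k))"
    by (metis poly_ip_sum[OF prob sets_M not_finite])
  also have "\<dots> = (\<Sum>k\<in>{0}. cnj (coeff q k) * ip (\<Phi>s n) (monom 1 k))"
    by (intro sum.mono_neutral_right) (auto simp: ip_reversed_monom ip_\<Phi>_monom)
  also have "\<dots> = cnj (coeff q 0) * cnj (ip (\<Phi> n) (monom 1 n))"
    using ip_reversed_monom[of 0 n] by simp
  finally show ?thesis by (simp add: ip_\<Phi>_low_degree degree_monom_eq)
qed

lemma ip_reversed_reversed: "n \<le> m \<Longrightarrow> ip (\<Phi>s m) (\<Phi>s n) = of_real (h m)"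
  using ip_reversed_low_degree[of "\<Phi>s n" m] degree_reversed[of n] by (simp add: coeff_0_reversed)

text \<open>All reversed polynomials have constant coefficient 1, so both mixed products equal
  \<open>h m\<close>. Convergence of \<open>h\<close> then makes the reversed polynomials a Cauchy
  sequence in the mean square.\<close>

lemma ip_reversed_diff:
  assumes "n \<le> m" shows "ip (\<Phi>s n - \<Phi>s m) (\<Phi>s n - \<Phi>s m) = of_real (h n - h m)"
  using ip_reversed_reversed[OF assms] ip_cnj[of "\<Phi>s n" "\<Phi>s m"]
  by (simp add: ip_diff_left ip_diff_right ip_reversed_self)

section \<open>Norms and their product formula\<close>

lemma h_pos: "h n > 0"
proof -
  have "\<Phi> n \<noteq> 0" using lead_coeff_\<Phi>[of n] by auto
  then have "h n \<noteq> 0"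
    using poly_ip_self_nonzero[OF prob sets_M not_finite] ip_\<Phi>_self[of n] by force
  moreover have "h n \<ge> 0" unfolding h_def by simp
  ultimately show ?thesis by simp
qed

lemma \<Phi>_0: "\<Phi> 0 = 1"
  using degree_\<Phi>[of 0] lead_coeff_\<Phi>[of 0] by (metis degree_eq_zeroE coeff_pCons_0 one_pCons)

lemma h_0: "h 0 = 1"
  by (simp add: h_def \<Phi>_0 prob_space)

text \<open>Pythagoras: multiplication by \<open>z\<close> is isometric on the circle, and
  \<open>\<Phi> (Suc n)\<close> is orthogonal to \<open>\<Phi>s n\<close>, which has degree at most
  \<open>n\<close>.\<close>

lemma h_Suc: "h (Suc n) = (1 - (norm (\<alpha> n))\<^sup>2) * h n"
proof -
  let ?z = "[:0, 1:] * \<Phi> n" and ?r = "smult (cnj (\<alpha> n)) (\<Phi>s n)"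
  have "ip ?z ?z = ip (\<Phi> n) (\<Phi> n)"
  proof (rule ip_cong)
    fix z :: complex assume z: "norm z = 1"
    have "poly ?z z * cnj (poly ?z z) = (z * cnj z) * (poly (\<Phi> n) z * cnj (poly (\<Phi> n) z))"
      by (simp add: mult_ac)
    then show "poly ?z z * cnj (poly ?z z) = poly (\<Phi> n) z * cnj (poly (\<Phi> n) z)"
      unfolding mult_cnj_circle[OF z] by simp
  qed
  moreover have z: "?z = \<Phi> (Suc n) + ?r" unfolding recursion by simp
  moreover have "ip (\<Phi> (Suc n)) (\<Phi>s n) = 0"
    using degree_reversed[of n] by (subst ip_\<Phi>_low_degree) (auto simp: coeff_eq_0)
  moreover from this have "ip (\<Phi>s n) (\<Phi> (Suc n)) = 0" using ip_cnj[of "\<Phi>s n"] by simp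
  ultimately have "of_real (h n) = of_real (h (Suc n)) + cnj (\<alpha> n) * \<alpha> n * of_real (h n)"
    unfolding z by (simp add: ip_add_left ip_add_right ip_smult_left ip_smult_right ip_\<Phi>_self ip_reversed_self mult_ac)
  moreover have "cnj (\<alpha> n) * \<alpha> n = of_real ((norm (\<alpha> n))\<^sup>2)"
    by (simp only: complex_norm_square mult.commute)
  ultimately have "h n = h (Suc n) + (norm (\<alpha> n))\<^sup>2 * h n"
    by (simp only: of_real_add[symmetric] of_real_mult[symmetric] of_real_eq_iff)
  then show ?thesis by (simp add: algebra_simps)
qed

text \<open>Consecutive norms are positive, hence so is their ratio
  \<open>1 - (norm (\<alpha> n))\<^sup>2\<close>.\<close>

lemma norm_\<alpha>: "norm (\<alpha> n) < 1"
proof -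
  have "(1 - (norm (\<alpha> n))\<^sup>2) > 0"
    using h_pos[of n] h_pos[of "Suc n"] unfolding h_Suc by (simp add: zero_less_mult_iff)
  then show ?thesis by (simp add: power2_less_1_iff abs_square_less_1)
qed

lemma h_decseq: "decseq h"
  unfolding decseq_Suc_iff h_Suc using h_pos by (simp add: mult_left_le_one_le less_imp_le norm_\<alpha> power_le_one)

lemma h_le_1: "h n \<le> 1"
  using decseqD[OF h_decseq, of 0 n] h_0 by simp

lemma h_diff_le: "n \<le> m \<Longrightarrow> h n - h m \<le> (\<Sum>k\<in>{n..<m}. (norm (\<alpha> k))\<^sup>2)"
proof (induction m rule: dec_induct)
  case (step m)
  have "h m - h (Suc m) = (norm (\<alpha> m))\<^sup>2 * h m" by (simp add: h_Suc algebra_simps)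
  also have "\<dots> \<le> (norm (\<alpha> m))\<^sup>2" using h_le_1 by (simp add: mult_left_le)
  finally show ?case using step by simp
qed simp

definition h_lim where "h_lim = lim h"

lemma h_tendsto: "h \<longlonglongrightarrow> h_lim"
proof -
  have "convergent h" using h_decseq by (rule decseq_convergent[where B = 0]) (auto intro: less_imp_le h_pos convergentI)
  then show ?thesis unfolding h_lim_def by (simp add: convergent_LIMSEQ_iff)
qed

lemma h_lim_le: "h_lim \<le> 1" "h_lim \<ge> 0"
  using h_tendsto by (auto intro: LIMSEQ_le_const2 LIMSEQ_le_const less_imp_le h_pos h_le_1)

end

section \<open>Weak convergence to Lebesgue measure\<close>

interpretation circle_lebesgue: finite_measure circle_lebesgue
proof
  have "cis -` space circle_borel \<inter> {0..<2*pi} = {0..<2*pi}"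
    by (auto simp: circle_borel_def space_restrict_space)
  then have "emeasure circle_lebesgue (space circle_lebesgue) = emeasure lborel {0..<2*pi}"
    unfolding circle_lebesgue_def
    by (subst emeasure_distr[OF measurable_cis_circle_borel])
       (auto simp: emeasure_restrict_space space_restrict_space)
  then show "emeasure circle_lebesgue (space circle_lebesgue) \<noteq> \<infinity>" by simp
qed

lemma compact_in_sets_circle_borel:
  "compact K \<Longrightarrow> K \<subseteq> sphere 0 1 \<Longrightarrow> K \<in> sets circle_borel"
  by (auto simp: circle_borel_def sets_restrict_space_iff compact_imp_closed)

lemma space_circle_lebesgue: "space circle_lebesgue = sphere 0 1"
  by (simp add: circle_lebesgue_def circle_borel_def space_restrict_space)

lemma continuous_measurable_circle:
  fixes f :: "complex \<Rightarrow> 'a::topological_space"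
  assumes "sets M = sets circle_borel" "continuous_on UNIV f"
  shows "f \<in> borel_measurable M"
  using borel_measurable_continuous_onI[OF assms(2)]
  unfolding measurable_cong_sets[OF assms(1) refl] circle_borel_def
  by (rule measurable_restrict_space1)

lemma finite_measure_integrable_continuous_circle:
  fixes f :: "complex \<Rightarrow> 'a::{banach, second_countable_topology}"
  assumes fin: "finite_measure M" and M: "sets M = sets circle_borel" and f: "continuous_on UNIV f"
  shows "integrable M f"
proof -
  have sp: "space M = sphere 0 1"
    using sets_eq_imp_space_eq[OF M] by (simp add: circle_borel_def space_restrict_space)
  have "compact (f ` sphere 0 1)"
    using f by (intro compact_continuous_image) (auto intro: continuous_on_subset)
  then obtain B where B: "\<And>z. z \<in> sphere 0 1 \<Longrightarrow> norm (f z) \<le> B"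
    using compact_imp_bounded[of "f ` sphere 0 1"] unfolding bounded_iff by blast
  show ?thesis
    by (rule finite_measure.integrable_const_bound[OF fin, of _ B]) (use B sp continuous_measurable_circle[OF M f] in auto)
qed

text \<open>Adding the null endpoint \<open>2 * pi\<close> gives a compact interval, to which the
  fundamental theorem of calculus applies.\<close>

lemma circle_lebesgue_integral:
  fixes f :: "complex \<Rightarrow> complex"
  assumes f: "continuous_on UNIV f"
  shows "(LINT z|circle_lebesgue. f z) = (LINT x|lborel. indicator {0..2*pi} x *\<^sub>R f (cis x))"
proof -
  have fm: "f \<in> borel_measurable circle_borel"
    by (rule continuous_measurable_circle[OF refl f])
  have c: "continuous_on UNIV (\<lambda>x. f (cis x))"
    by (intro continuous_on_compose2[OF f] continuous_intros) auto
  have "(LINT z|circle_lebesgue. f z) = (LINT x|restrict_space lborel {0..<2*pi}. f (cis x))"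
    unfolding circle_lebesgue_def by (rule integral_distr[OF measurable_cis_circle_borel fm])
  also have "\<dots> = (LINT x|lborel. indicator {0..<2*pi} x *\<^sub>R f (cis x))"
    by (subst integral_restrict_space) auto
  also have "\<dots> = (LINT x|lborel. indicator {0..2*pi} x *\<^sub>R f (cis x))"
  proof (rule integral_cong_AE)
    show "AE x in lborel. indicator {0..<2*pi} x *\<^sub>R f (cis x) = indicator {0..2*pi} x *\<^sub>R f (cis x)"
      using AE_lborel_singleton[of "2*pi"] by eventually_elim (auto simp: indicator_def)
  qed (use borel_measurable_continuous_onI[OF c] in measurable)
  finally show ?thesis .
qed

lemma circle_lebesgue_moment:
  "(LINT z|circle_lebesgue. z ^ j * cnj z ^ n) = (if j = n then of_real (2 * pi) else 0)"
proof -
  define k where "k = real j - real n"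
  have cis: "cis x ^ j * cnj (cis x) ^ n = cis (k * x)" for x
    by (simp add: k_def cis_cnj Complex.DeMoivre cis_mult algebra_simps)
  have "(LINT z|circle_lebesgue. z ^ j * cnj z ^ n) = (LINT x|lborel. indicator {0..2*pi} x *\<^sub>R cis (k * x))"
    by (subst circle_lebesgue_integral) (auto intro!: continuous_intros simp: cis)
  also have "\<dots> = (if j = n then of_real (2 * pi) else 0)"
  proof (cases "j = n")
    case True
    then show ?thesis by (simp add: k_def scaleR_conv_of_real)
  next
    case False
    then have k: "k \<noteq> 0" by (simp add: k_def)
    have "(LINT x|lborel. indicator {0..2*pi} x *\<^sub>R cis (k * x)) =
        cis (k * (2*pi)) / (\<i> * of_real k) - cis (k * 0) / (\<i> * of_real k)"
    proof (rule integral_FTC_atLeastAtMost)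
      fix x
      have "((\<lambda>x. cis (k * x)) has_vector_derivative (k *\<^sub>R (\<i> * cis (k * x)))) (at x within {0..2*pi})"
        by (auto intro!: derivative_eq_intros simp: has_vector_derivative_def)
      then show "((\<lambda>x. cis (k * x) / (\<i> * of_real k)) has_vector_derivative cis (k * x)) (at x within {0..2*pi})"
        using k by (auto dest: has_vector_derivative_divide[where a = "\<i> * of_real k"] simp: scaleR_conv_of_real)
    qed (auto intro!: continuous_intros)
    also have "cis (k * (2*pi)) = 1"
    proof -
      have "k * (2*pi) = 2 * pi * of_int (int j - int n)" by (simp add: k_def algebra_simps)
      then show ?thesis by (simp only: cis_multiple_2pi Ints_of_int)
    qed
    finally show ?thesis using False by simp
  qed
  finally show ?thesis .
qed

text \<open>On the circle \<open>cnj z\<close> inverts \<open>z\<close>, so real polynomials in the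
  coordinates become Laurent polynomials. This form reduces integrals to moments.\<close>

lemma real_polynomial_function_circle_laurent:
  fixes p :: "complex \<Rightarrow> real"
  assumes "real_polynomial_function p"
  shows "\<exists>q n. \<forall>z. norm z = 1 \<longrightarrow> complex_of_real (p z) = poly q z * cnj z ^ n"
  using assms
proof induction
  case (linear f)
  \<comment> \<open>Chosen so that \<open>f z = c * z + cnj c * cnj z\<close>; inserting
    \<open>z * cnj z = 1\<close> in the first term pulls out \<open>cnj z\<close>.\<close>
  define c where "c = Complex (f 1 / 2) (- f \<i> / 2)"
  have "complex_of_real (f z) = poly [:cnj c, 0, c:] z * cnj z ^ 1" if "norm z = 1" for z
  proof -
    interpret bounded_linear f by (rule linear)
    have "f z = f (Re z *\<^sub>R 1 + Im z *\<^sub>R \<i>)"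
      by (intro arg_cong[where f = f]) (simp add: complex_eq_iff)
    also have "\<dots> = Re z * f 1 + Im z * f \<i>" unfolding add scaleR by simp
    finally have "f z = Re z * f 1 + Im z * f \<i>" .
    then have "complex_of_real (f z) = c * z + cnj c * cnj z"
      by (simp add: c_def complex_eq_iff)
    also have "\<dots> = c * z * (z * cnj z) + cnj c * cnj z"
      using that by (simp add: complex_norm_square[symmetric])
    finally show ?thesis by (simp add: algebra_simps)
  qed
  then show ?case by blast
next
  case (const c)
  show ?case by (rule exI[of _ "[:of_real c:]"], rule exI[of _ 0]) simp
next
  case (add f g)
  then obtain p m q n where pq: "\<And>z. norm z = 1 \<Longrightarrow> complex_of_real (f z) = poly p z * cnj z ^ m"
    "\<And>z. norm z = 1 \<Longrightarrow> complex_of_real (g z) = poly q z * cnj z ^ n" by blast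
  have "complex_of_real (f z + g z) = poly (p * monom 1 n + q * monom 1 m) z * cnj z ^ (m + n)" if z: "norm z = 1" for z
  proof -
    have "z * cnj z = 1" using z by (simp add: complex_norm_square[symmetric])
    then have *: "z ^ k * cnj z ^ k = 1" for k by (simp flip: power_mult_distrib)
    have "poly (p * monom 1 n + q * monom 1 m) z * cnj z ^ (m + n) =
        poly p z * cnj z ^ m * (z ^ n * cnj z ^ n) + poly q z * cnj z ^ n * (z ^ m * cnj z ^ m)"
      by (simp add: poly_monom power_add algebra_simps)
    then show ?thesis unfolding * using pq z by simp
  qed
  then show ?case by blast
next
  case (mult f g)
  then obtain p m q n where pq: "\<And>z. norm z = 1 \<Longrightarrow> complex_of_real (f z) = poly p z * cnj z ^ m"
    "\<And>z. norm z = 1 \<Longrightarrow> complex_of_real (g z) = poly q z * cnj z ^ n" by blast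
  have "complex_of_real (f z * g z) = poly (p * q) z * cnj z ^ (m + n)" if "norm z = 1" for z
    using pq[OF that] by (simp add: power_add mult_ac)
  then show ?case by blast
qed

context circle_orthogonal_polys
begin

text \<open>The shifted polynomial \<open>monom 1 k * \<Phi>s m\<close> has degree at most
  \<open>m + k\<close> and no constant term, so it is orthogonal to \<open>\<Phi>s (m + k)\<close>.
  Subtracting that from the second argument leaves a factor whose squared norm
  \<open>h m - h (m + k)\<close> tends to 0.\<close>

lemma reversed_moment_tendsto_0:
  assumes k: "k > 0"
  shows "(\<lambda>m. ip (monom 1 k * \<Phi>s m) (\<Phi>s m)) \<longlonglongrightarrow> 0"
proof (rule LIMSEQ_I)
  fix r :: real assume r: "r > 0"
  have "(\<lambda>m. h m - h (m + k)) \<longlonglongrightarrow> h_lim - h_lim"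
    by (intro tendsto_diff h_tendsto LIMSEQ_ignore_initial_segment)
  then have "\<forall>\<^sub>F m in sequentially. h m - h (m + k) < r\<^sup>2"
    using r by (intro order_tendstoD) auto
  then obtain m0 where m0: "\<And>m. m \<ge> m0 \<Longrightarrow> h m - h (m + k) < r\<^sup>2"
    unfolding eventually_sequentially by blast
  have "norm (ip (monom 1 k * \<Phi>s m) (\<Phi>s m)) < r" if "m \<ge> m0" for m
  proof -
    let ?p = "monom 1 k * \<Phi>s m"
    have "degree ?p \<le> m + k"
      using degree_mult_le[of "monom 1 k" "\<Phi>s m"] degree_monom_le[of "1::complex" k] degree_reversed[of m] by linarith
    then have "ip (\<Phi>s (m + k)) ?p = 0"
      using k by (subst ip_reversed_low_degree) (simp_all add: coeff_monom_mult)
    then have eq: "ip ?p (\<Phi>s m) = ip ?p (\<Phi>s m - \<Phi>s (m + k))"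
      using ip_cnj[of ?p "\<Phi>s (m + k)"] by (simp add: ip_diff_right)
    have pp: "ip ?p ?p = of_real (h m)"
    proof -
      have "ip ?p ?p = ip (\<Phi>s m) (\<Phi>s m)"
      proof (rule ip_cong)
        fix z :: complex assume z: "norm z = 1"
        have "poly ?p z * cnj (poly ?p z) = (z * cnj z) ^ k * (poly (\<Phi>s m) z * cnj (poly (\<Phi>s m) z))"
          by (simp add: poly_monom power_mult_distrib mult_ac)
        then show "poly ?p z * cnj (poly ?p z) = poly (\<Phi>s m) z * cnj (poly (\<Phi>s m) z)"
          unfolding mult_cnj_circle[OF z] by simp
      qed
      then show ?thesis by (simp add: ip_reversed_self)
    qed
    have "norm (ip ?p (\<Phi>s m)) \<le> (r * h m + (h m - h (m + k)) / r) / 2"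
      unfolding eq using norm_ip_le[OF r, of ?p "\<Phi>s m - \<Phi>s (m + k)"] ip_reversed_diff[of m "m + k"]
      by (simp add: pp)
    also have "\<dots> < (r * 1 + r\<^sup>2 / r) / 2"
      using r m0[OF that] by (intro divide_strict_right_mono add_le_less_mono mult_left_mono h_le_1) auto
    also have "\<dots> = r" using r by (simp add: power2_eq_square)
    finally show ?thesis .
  qed
  then show "\<exists>no. \<forall>m\<ge>no. norm (ip (monom 1 k * \<Phi>s m) (\<Phi>s m) - 0) < r" by auto
qed

text \<open>Since \<Phi> and its reversal have equal modulus on the circle, the moment depends on
  \<open>j - n\<close> alone when \<open>n \<le> j\<close>; conjugation covers the other
  case.\<close>

lemma weighted_monomial_tendsto:
  "(\<lambda>m. LINT z|M. z ^ j * cnj z ^ n * of_real ((norm (poly (\<Phi> m) z))\<^sup>2)) \<longlonglongrightarrow> (if j = n then of_real h_lim else 0)"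
proof -
  have ge: "(LINT z|M. z ^ j * cnj z ^ n * of_real ((norm (poly (\<Phi> m) z))\<^sup>2)) = ip (monom 1 (j - n) * \<Phi>s m) (\<Phi>s m)"
    if "n \<le> j" for j n m
    unfolding ip_def
  proof (intro Bochner_Integration.integral_cong refl)
    fix z assume "z \<in> space M"
    then have z: "norm z = 1" by (rule norm_M)
    have "z ^ j * cnj z ^ n = z ^ (j - n) * (z * cnj z) ^ n"
      using that by (simp add: power_mult_distrib flip: power_add)
    then have "z ^ j * cnj z ^ n = z ^ (j - n)" unfolding mult_cnj_circle[OF z] by simp
    then show "z ^ j * cnj z ^ n * of_real ((norm (poly (\<Phi> m) z))\<^sup>2) =
        poly (monom 1 (j - n) * \<Phi>s m) z * cnj (poly (\<Phi>s m) z)"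
      unfolding norm_reversed[OF z, symmetric] complex_norm_square by (simp add: poly_monom mult_ac)
  qed
  show ?thesis
  proof (cases n j rule: linorder_cases)
    case less
    then show ?thesis unfolding ge[OF less_imp_le[OF less]] using reversed_moment_tendsto_0[of "j - n"] by simp
  next
    case equal
    then show ?thesis unfolding ge[OF eq_imp_le[OF equal]] using tendsto_of_real[OF h_tendsto, where 'a=complex]
      by (simp add: ip_reversed_self monom_0 flip: one_pCons)
  next
    case greater
    have "(LINT z|M. z ^ j * cnj z ^ n * of_real ((norm (poly (\<Phi> m) z))\<^sup>2)) =
        cnj (LINT z|M. z ^ n * cnj z ^ j * of_real ((norm (poly (\<Phi> m) z))\<^sup>2))" for m
      by (subst Bochner_Integration.integral_cnj[symmetric]) (simp add: mult_ac del: Bochner_Integration.integral_cnj)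
    then have "(LINT z|M. z ^ j * cnj z ^ n * of_real ((norm (poly (\<Phi> m) z))\<^sup>2)) =
        cnj (ip (monom 1 (n - j) * \<Phi>s m) (\<Phi>s m))" for m
      using greater by (simp only: ge less_imp_le)
    then show ?thesis using tendsto_cnj[OF reversed_moment_tendsto_0[of "n - j"]] greater by simp
  qed
qed

text \<open>By linearity in the Laurent coefficients only the one of index \<open>n\<close>
  survives, both in the limit and in the Lebesgue integral.\<close>

lemma weighted_polynomial_tendsto:
  fixes p :: "complex \<Rightarrow> real"
  assumes p: "real_polynomial_function p"
  shows "(\<lambda>m. LINT z|M. p z * (norm (poly (\<Phi> m) z))\<^sup>2) \<longlonglongrightarrow> h_lim / (2 * pi) * (LINT z|circle_lebesgue. p z)"
proof -
  obtain q n where q: "\<And>z. norm z = 1 \<Longrightarrow> complex_of_real (p z) = poly q z * cnj z ^ n"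
    using real_polynomial_function_circle_laurent[OF p] by blast
  have q': "complex_of_real (p z) = (\<Sum>j\<le>degree q. coeff q j * (z ^ j * cnj z ^ n))" if "norm z = 1" for z
    unfolding q[OF that] poly_altdef by (simp add: sum_distrib_right mult.assoc)
  have L: "of_real (LINT z|circle_lebesgue. p z) = (if n \<le> degree q then coeff q n * of_real (2 * pi) else 0)"
  proof -
    have "of_real (LINT z|circle_lebesgue. p z) = (LINT z|circle_lebesgue. (\<Sum>j\<le>degree q. coeff q j * (z ^ j * cnj z ^ n)))"
      unfolding integral_complex_of_real[symmetric]
      by (intro Bochner_Integration.integral_cong refl q') (simp add: space_circle_lebesgue)
    also have "\<dots> = (\<Sum>j\<le>degree q. coeff q j * (LINT z|circle_lebesgue. z ^ j * cnj z ^ n))"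
      by (subst Bochner_Integration.integral_sum)
         (auto intro!: integrable_mult_right finite_measure_integrable_continuous_circle circle_lebesgue.finite_measure_axioms sets_circle_lebesgue continuous_intros)
    also have "\<dots> = (if n \<le> degree q then coeff q n * of_real (2 * pi) else 0)"
      unfolding circle_lebesgue_moment by (simp add: if_distrib cong: if_cong)
    finally show ?thesis .
  qed
  have "complex_of_real (LINT z|M. p z * (norm (poly (\<Phi> m) z))\<^sup>2) =
      (\<Sum>j\<le>degree q. coeff q j * (LINT z|M. z ^ j * cnj z ^ n * of_real ((norm (poly (\<Phi> m) z))\<^sup>2)))" for m
  proof -
    have "complex_of_real (LINT z|M. p z * (norm (poly (\<Phi> m) z))\<^sup>2) =
        (LINT z|M. (\<Sum>j\<le>degree q. coeff q j * (z ^ j * cnj z ^ n * of_real ((norm (poly (\<Phi> m) z))\<^sup>2))))"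
      unfolding integral_complex_of_real[symmetric]
      by (intro Bochner_Integration.integral_cong refl)
         (simp add: q' norm_M sum_distrib_right mult.assoc)
    also have "\<dots> = (\<Sum>j\<le>degree q. coeff q j * (LINT z|M. z ^ j * cnj z ^ n * of_real ((norm (poly (\<Phi> m) z))\<^sup>2)))"
      by (subst Bochner_Integration.integral_sum)
         (auto intro!: integrable_mult_right integrable_continuous continuous_intros)
    finally show ?thesis .
  qed
  moreover have "(\<lambda>m. \<Sum>j\<le>degree q. coeff q j * (LINT z|M. z ^ j * cnj z ^ n * of_real ((norm (poly (\<Phi> m) z))\<^sup>2)))
      \<longlonglongrightarrow> (\<Sum>j\<le>degree q. coeff q j * (if j = n then of_real h_lim else 0))"
    by (intro tendsto_intros weighted_monomial_tendsto)
  moreover have "(\<Sum>j\<le>degree q. coeff q j * (if j = n then of_real h_lim else 0)) =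
      complex_of_real (h_lim / (2 * pi) * (LINT z|circle_lebesgue. p z))"
    unfolding of_real_mult L by (simp add: if_distrib cong: if_cong)
  ultimately have "(\<lambda>m. complex_of_real (LINT z|M. p z * (norm (poly (\<Phi> m) z))\<^sup>2))
      \<longlonglongrightarrow> complex_of_real (h_lim / (2 * pi) * (LINT z|circle_lebesgue. p z))"
    by simp
  then show ?thesis by (simp only: tendsto_of_real_iff)
qed

end

section \<open>Decay on Lebesgue-null sets\<close>

text \<open>Near a compact Lebesgue-null set, compare the indicator with continuous functions of small
  Lebesgue integral and those with polynomials.\<close>

lemma compact_null_dominated:
  fixes K :: "complex set"
  assumes K: "compact K" "K \<noteq> {}" "emeasure circle_lebesgue K = 0" "K \<subseteq> sphere 0 1" and e: "e > 0"
  obtains p where "real_polynomial_function p" "\<And>z. norm z = 1 \<Longrightarrow> indicator K z \<le> p z"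
    "(LINT z|circle_lebesgue. p z) \<le> e"
proof -
  \<comment> \<open>Tent functions that equal 1 on \<open>K\<close> and tend to 0 off it, because a
    point outside a closed set has positive distance to it.\<close>
  define g where "g n z = max 0 (1 - real n * infdist z K)" for n and z :: complex
  have gc: "continuous_on A (g n)" for n A
    unfolding g_def by (intro continuous_intros)
  have gint: "integrable circle_lebesgue (g n)" for n
    by (rule finite_measure_integrable_continuous_circle[OF circle_lebesgue.finite_measure_axioms sets_circle_lebesgue gc])
  have K_sets: "K \<in> sets circle_lebesgue"
    unfolding sets_circle_lebesgue by (rule compact_in_sets_circle_borel[OF K(1,4)])
  have "(\<lambda>n. LINT z|circle_lebesgue. g n z) \<longlonglongrightarrow> (LINT z|circle_lebesgue. indicator K z)"
  proof (rule integral_dominated_convergence[where w = "\<lambda>_. 1"])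
    show "AE z in circle_lebesgue. (\<lambda>n. g n z) \<longlonglongrightarrow> indicator K z"
    proof (rule AE_I2)
      fix z :: complex
      show "(\<lambda>n. g n z) \<longlonglongrightarrow> indicator K z"
      proof (cases "z \<in> K")
        case True
        then show ?thesis by (simp add: g_def)
      next
        case False
        then have d: "infdist z K > 0"
          using in_closed_iff_infdist_zero[OF compact_imp_closed[OF K(1)] K(2), of z] infdist_nonneg[of z K] by linarith
        obtain N where N: "1 / infdist z K < real N" using reals_Archimedean2 by blast
        have "g n z = 0" if "n \<ge> N" for n
        proof -
          have "1 / infdist z K < real n" using N that by (meson less_le_trans of_nat_le_iff)
          then have "1 < real n * infdist z K" using d by (simp add: field_simps)
          then show ?thesis by (simp add: g_def)
        qed
        then have "\<forall>\<^sub>F n in sequentially. g n z = 0" unfolding eventually_sequentially by blast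
        then show ?thesis using False by (simp add: tendsto_eventually)
      qed
    qed
    show "AE z in circle_lebesgue. norm (g n z) \<le> 1" for n
      by (intro AE_I2) (simp add: g_def infdist_nonneg)
    show "indicator K \<in> borel_measurable circle_lebesgue" using K_sets by (rule borel_measurable_indicator)
  qed (use gint in auto)
  then have "(\<lambda>n. LINT z|circle_lebesgue. g n z) \<longlonglongrightarrow> 0"
    using K(3) K_sets by (simp add: measure_def)
  then have "\<forall>\<^sub>F n in sequentially. (LINT z|circle_lebesgue. g n z) < e / 2"
    using e by (intro order_tendstoD) auto
  then obtain n where n: "(LINT z|circle_lebesgue. g n z) < e / 2"
    unfolding eventually_sequentially by blast
  \<comment> \<open>The added 1 keeps the divisor positive; with \<open>d = e / (4 * T)\<close> the
    total error \<open>2 * d * T\<close> is \<open>e / 2\<close>.\<close>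
  define T where "T = measure circle_lebesgue (space circle_lebesgue) + 1"
  have T: "T > 0" unfolding T_def by (simp add: add_nonneg_pos)
  define d where "d = e / (4 * T)"
  have d: "d > 0" using e T by (simp add: d_def)
  obtain p where p: "real_polynomial_function p" "\<And>z. z \<in> sphere 0 1 \<Longrightarrow> \<bar>g n z - p z\<bar> < d"
    using Stone_Weierstrass_real_polynomial_function[OF compact_sphere gc d] by blast
  have pc: "continuous_on UNIV p"
    using p(1) by (intro continuous_at_imp_continuous_on) (auto intro: continuous_real_polymonial_function)
  show thesis
  proof (rule that)
    \<comment> \<open>The shift by \<open>d\<close> turns the two-sided approximation of
      \<open>g n\<close> into a majorant.\<close>
    show "real_polynomial_function (\<lambda>z. p z + d)" by (intro real_polynomial_function.intros p)
    fix z :: complex assume "norm z = 1"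
    then have "g n z \<le> p z + d" using p(2)[of z] by (auto simp: abs_less_iff)
    moreover have "indicator K z \<le> g n z" by (auto simp: indicator_def g_def)
    ultimately show "indicator K z \<le> p z + d" by linarith
  next
    have "(LINT z|circle_lebesgue. p z + d) \<le> (LINT z|circle_lebesgue. g n z + 2 * d)"
    proof (rule integral_mono)
      show "integrable circle_lebesgue (\<lambda>z. p z + d)" "integrable circle_lebesgue (\<lambda>z. g n z + 2 * d)"
        by (auto intro!: finite_measure_integrable_continuous_circle[OF circle_lebesgue.finite_measure_axioms sets_circle_lebesgue]
              continuous_intros gc pc)
      fix z assume "z \<in> space circle_lebesgue"
      then show "p z + d \<le> g n z + 2 * d" using p(2)[of z] by (auto simp: abs_less_iff space_circle_lebesgue)
    qed
    also have "\<dots> = (LINT z|circle_lebesgue. g n z) + 2 * d * (T - 1)"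
      using gint by (simp add: T_def)
    also have "\<dots> \<le> e / 2 + 2 * d * T"
      using n d by (intro add_mono mult_left_mono) auto
    also have "\<dots> = e" using T by (simp add: d_def)
    finally show "(LINT z|circle_lebesgue. p z + d) \<le> e" .
  qed
qed

context circle_orthogonal_polys
begin

lemma integrable_indicator_\<Phi>:
  "K \<in> sets M \<Longrightarrow> integrable M (\<lambda>z. indicator K z * (norm (poly (\<Phi> n) z))\<^sup>2)"
  using integrable_mult_indicator[OF _ integrable_norm_power2[of "\<Phi> n"], of K] by simp

text \<open>A polynomial majorant of the indicator with Lebesgue integral at most \<open>e\<close>
  transfers the weak limit to \<open>K\<close>; \<open>h_lim \<le> 1\<close> and
  \<open>2 * pi > 1\<close> give the strict bound.\<close>

lemma null_compact_tendsto_0: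
  assumes K: "compact K" "K \<subseteq> sphere 0 1" "emeasure circle_lebesgue K = 0"
  shows "(\<lambda>m. LINT z|M. indicator K z * (norm (poly (\<Phi> m) z))\<^sup>2) \<longlonglongrightarrow> 0"
proof (cases "K = {}")
  case False
  have K_sets: "K \<in> sets M"
    unfolding sets_M by (rule compact_in_sets_circle_borel[OF K(1,2)])
  show ?thesis
  proof (rule order_tendstoI)
    fix e :: real assume e: "e > 0"
    obtain p where p: "real_polynomial_function p" "\<And>z. norm z = 1 \<Longrightarrow> indicator K z \<le> p z"
      "(LINT z|circle_lebesgue. p z) \<le> e"
      using compact_null_dominated[OF K(1) False K(3,2) e] by blast
    have pc: "continuous_on UNIV p"
      using p(1) by (intro continuous_at_imp_continuous_on) (auto intro: continuous_real_polymonial_function)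
    have "h_lim / (2 * pi) * (LINT z|circle_lebesgue. p z) \<le> 1 / (2 * pi) * e"
      by (rule mult_mono[OF _ p(3)])
         (use h_lim_le in \<open>auto simp: divide_right_mono space_circle_lebesgue
            intro!: integral_nonneg_AE AE_I2 order_trans[OF _ p(2)]\<close>)
    also have "\<dots> < e" using e pi_gt3 by (simp add: field_simps)
    finally have "\<forall>\<^sub>F m in sequentially. (LINT z|M. p z * (norm (poly (\<Phi> m) z))\<^sup>2) < e"
      by (rule order_tendstoD[OF weighted_polynomial_tendsto[OF p(1)]])
    then show "\<forall>\<^sub>F m in sequentially. (LINT z|M. indicator K z * (norm (poly (\<Phi> m) z))\<^sup>2) < e"
    proof eventually_elim
      case (elim m)
      have "(LINT z|M. indicator K z * (norm (poly (\<Phi> m) z))\<^sup>2) \<le> (LINT z|M. p z * (norm (poly (\<Phi> m) z))\<^sup>2)"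
      proof (rule integral_mono[OF integrable_indicator_\<Phi>[OF K_sets]])
        show "integrable M (\<lambda>z. p z * (norm (poly (\<Phi> m) z))\<^sup>2)"
          by (intro finite_measure_integrable_continuous_circle[OF finite_measure_axioms sets_M]
              continuous_intros pc)
        show "indicator K z * (norm (poly (\<Phi> m) z))\<^sup>2 \<le> p z * (norm (poly (\<Phi> m) z))\<^sup>2" if "z \<in> space M" for z
          using p(2)[OF norm_M[OF that]] by (rule mult_right_mono) simp
      qed
      then show ?case using elim by linarith
    qed
  qed (auto intro!: always_eventually less_le_trans[OF _ integral_nonneg_AE])
qed simp

text \<open>The limit of the reversed polynomials vanishes on \<open>K\<close>, so only the distance to the limit contributes.\<close>

lemma null_compact_integral_le:
  assumes K: "compact K" "K \<subseteq> sphere 0 1" "emeasure circle_lebesgue K = 0"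
  shows "(LINT z|M. indicator K z * (norm (poly (\<Phi> n) z))\<^sup>2) \<le> 2 * (h n - h_lim)"
proof -
  have K_sets: "K \<in> sets M"
    unfolding sets_M by (rule compact_in_sets_circle_borel[OF K(1,2)])
  have "(\<lambda>m. 2 * (h n - h m) + 2 * (LINT z|M. indicator K z * (norm (poly (\<Phi> m) z))\<^sup>2)) \<longlonglongrightarrow> 2 * (h n - h_lim) + 2 * 0"
    by (intro tendsto_intros h_tendsto null_compact_tendsto_0 K)
  moreover have "(LINT z|M. indicator K z * (norm (poly (\<Phi> n) z))\<^sup>2)
      \<le> 2 * (h n - h m) + 2 * (LINT z|M. indicator K z * (norm (poly (\<Phi> m) z))\<^sup>2)" if "m \<ge> n" for m
  proof -
    have "(LINT z|M. indicator K z * (norm (poly (\<Phi> n) z))\<^sup>2) \<le>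
        (LINT z|M. 2 * (norm (poly (\<Phi>s n - \<Phi>s m) z))\<^sup>2 + 2 * (indicator K z * (norm (poly (\<Phi> m) z))\<^sup>2))"
    proof (rule integral_mono)
      fix z assume "z \<in> space M"
      then have z: "norm z = 1" by (rule norm_M)
      let ?a = "norm (poly (\<Phi>s n) z)" and ?b = "norm (poly (\<Phi>s m) z)" and ?d = "norm (poly (\<Phi>s n - \<Phi>s m) z)"
      have "?a \<le> ?d + ?b" using norm_triangle_ineq2[of "poly (\<Phi>s n) z" "poly (\<Phi>s m) z"] by simp
      then have "?a\<^sup>2 \<le> (?d + ?b)\<^sup>2" by (rule power_mono) simp
      also have "\<dots> \<le> 2 * ?d\<^sup>2 + 2 * ?b\<^sup>2" using sum_squares_bound[of ?d ?b] by (simp add: power2_sum)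
      finally show "indicator K z * (norm (poly (\<Phi> n) z))\<^sup>2 \<le>
          2 * ?d\<^sup>2 + 2 * (indicator K z * (norm (poly (\<Phi> m) z))\<^sup>2)"
        unfolding norm_reversed[OF z] by (auto simp: indicator_def)
    qed (intro Bochner_Integration.integrable_add integrable_mult_right integrable_norm_power2 integrable_indicator_\<Phi> K_sets)+
    also have "\<dots> = 2 * (LINT z|M. (norm (poly (\<Phi>s n - \<Phi>s m) z))\<^sup>2) + 2 * (LINT z|M. indicator K z * (norm (poly (\<Phi> m) z))\<^sup>2)"
      using integrable_norm_power2[of "\<Phi>s n - \<Phi>s m"] integrable_indicator_\<Phi>[OF K_sets, of m]
      by (subst Bochner_Integration.integral_add) (auto simp del: poly_diff)
    also have "(LINT z|M. (norm (poly (\<Phi>s n - \<Phi>s m) z))\<^sup>2) = h n - h m"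
      using ip_reversed_diff[OF that] unfolding ip_self of_real_eq_iff .
    finally show ?thesis .
  qed
  ultimately show ?thesis by (intro LIMSEQ_le_const) auto
qed

text \<open>A Borel-Cantelli type argument: scaling by \<open>(5/4)^i\<close> turns the rate 3/4 of
  the integrals into 15/16, which is still summable. So the scaled series converges almost
  everywhere, and its sum bounds each term and serves as \<open>c\<close>.\<close>

lemma null_compact_AE_decay:
  assumes K: "compact K" "K \<subseteq> sphere 0 1" "emeasure circle_lebesgue K = 0"
    and D: "\<And>i. (\<Sum>k<2^i. real (k+1) * (norm (\<alpha> k))\<^sup>2) \<le> C * real (i+1)"
  shows "AE z in M. z \<in> K \<longrightarrow> (\<exists>c. \<forall>i. (norm (poly (\<Phi> (2^i)) z))\<^sup>2 \<le> c * (4/5)^i)"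
proof -
  have K_sets: "K \<in> sets M"
    unfolding sets_M by (rule compact_in_sets_circle_borel[OF K(1,2)])
  have h: "h (2^i) - h_lim \<le> 8 * C * (3/4)^i" for i
  proof (rule LIMSEQ_le_const2)
    show "(\<lambda>m. h (2^i) - h m) \<longlonglongrightarrow> h (2^i) - h_lim" by (intro tendsto_intros h_tendsto)
    show "\<exists>N. \<forall>m\<ge>N. h (2^i) - h m \<le> 8 * C * (3/4)^i"
      using h_diff_le dyadic_tail_sum_le[OF D] order_trans by blast
  qed
  define f where "f i z = (5/4)^i * (indicator K z * (norm (poly (\<Phi> (2^i)) z))\<^sup>2)" for i z
  have f0: "f i z \<ge> 0" for i z by (simp add: f_def)
  have fint: "integrable M (f i)" for i
    unfolding f_def by (intro integrable_mult_right integrable_indicator_\<Phi> K_sets)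
  have fle: "(LINT z|M. f i z) \<le> 16 * C * (15/16)^i" for i
  proof -
    have "(LINT z|M. f i z) = (5/4)^i * (LINT z|M. indicator K z * (norm (poly (\<Phi> (2^i)) z))\<^sup>2)"
      unfolding f_def by simp
    also have "\<dots> \<le> (5/4)^i * (2 * (8 * C * (3/4)^i))"
      using null_compact_integral_le[OF K, of "2^i"] h[of i] by (intro mult_left_mono) auto
    also have "\<dots> = 16 * C * ((5/4) * (3/4))^i" unfolding power_mult_distrib by simp
    finally show ?thesis by simp
  qed
  have sm: "summable (\<lambda>i. 16 * C * (15/16)^i)" by (intro summable_mult summable_geometric) simp
  have "(\<integral>\<^sup>+z. (\<Sum>i. ennreal (f i z)) \<partial>M) = (\<Sum>i. \<integral>\<^sup>+z. ennreal (f i z) \<partial>M)"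
    by (rule nn_integral_suminf) (use fint in measurable)
  also have "\<dots> = (\<Sum>i. ennreal (LINT z|M. f i z))"
    using f0 fint by (subst nn_integral_eq_integral) auto
  also have "\<dots> \<le> (\<Sum>i. ennreal (16 * C * (15/16)^i))"
    by (intro suminf_le ennreal_leI fle summableI)
  also have "\<dots> < \<infinity>"
  proof (subst suminf_ennreal2[OF _ sm])
    show "0 \<le> 16 * C * (15/16)^i" for i
      by (rule order_trans[OF Bochner_Integration.integral_nonneg fle]) (rule f0)
  qed simp
  finally have "AE z in M. (\<Sum>i. ennreal (f i z)) \<noteq> \<infinity>"
    using fint by (intro nn_integral_noteq_infinite) (measurable, auto)
  then show ?thesis
  proof eventually_elim
    case (elim z)
    show ?case
    proof (intro impI exI allI)
      fix i assume z: "z \<in> K"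
      let ?s = "\<Sum>i. ennreal (f i z)"
      have "ennreal (f i z) \<le> ?s" using sum_le_suminf[of "\<lambda>i. ennreal (f i z)" "{i}"] by simp
      then have "f i z \<le> enn2real ?s"
        using elim f0 by (metis enn2real_ennreal enn2real_mono top.not_eq_extremum infinity_ennreal_def)
      then show "(norm (poly (\<Phi> (2^i)) z))\<^sup>2 \<le> enn2real ?s * (4/5)^i"
        using z by (simp add: f_def power_divide field_simps)
    qed
  qed
qed

end

section \<open>From compact null sets to the singular continuous part\<close>

theorem theorem1:
  fixes \<mu> \<mu>ac \<mu>sc \<mu>pp :: "complex measure"
    and \<alpha> :: "nat \<Rightarrow> complex"
  assumes "prob_space \<mu>"
    and "sets \<mu> = sets circle_borel"
    and "\<not> finitely_supported \<mu>"
    and "verblunsky_coeffs \<mu> \<alpha>"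
    and "\<exists>A::real. \<forall>N::nat. N \<ge> 2 \<longrightarrow>
           (\<Sum>n = 0..N. real (n + 1) * (norm (\<alpha> n))\<^sup>2) \<le> A * ln (real N)"
    and "lebesgue_decomposition circle_lebesgue \<mu> \<mu>ac \<mu>sc \<mu>pp"
  shows "\<mu>sc = null_measure \<mu>"
proof -
  obtain \<Phi> where \<Phi>: "monic_orthogonal_polys \<mu> \<Phi>"
    "\<And>n. \<Phi> (Suc n) = [:0, 1:] * \<Phi> n - smult (cnj (\<alpha> n)) (reversed_poly (\<Phi> n))"
    using assms(4) unfolding verblunsky_coeffs_def by blast
  interpret circle_orthogonal_polys \<mu> \<Phi> \<alpha>
    by (intro circle_orthogonal_polys.intro assms(1-3) \<Phi>)
  obtain A where A: "\<And>N. N \<ge> 2 \<Longrightarrow> (\<Sum>n = 0..N. real (n + 1) * (norm (\<alpha> n))\<^sup>2) \<le> A * ln (real N)"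
    using assms(5) by blast
  have D: "(\<Sum>k<2^i. real (k+1) * (norm (\<alpha> k))\<^sup>2) \<le> (A * ln 2) * real (i+1)" for i
  proof -
    \<comment> \<open>The exponent \<open>i+1\<close> keeps the upper limit at least 2 even for
      \<open>i = 0\<close>.\<close>
    have "(\<Sum>k<2^i. real (k+1) * (norm (\<alpha> k))\<^sup>2) \<le> (\<Sum>k = 0..2^(i+1). real (k+1) * (norm (\<alpha> k))\<^sup>2)"
      using power_increasing[of i "i+1" "2::nat"] by (intro sum_mono2) auto
    also have "\<dots> \<le> A * ln (real (2^(i+1)))"
      using power_increasing[of 1 "i+1" "2::nat"] by (intro A) simp
    also have "\<dots> = (A * ln 2) * real (i+1)" by (simp add: ln_realpow algebra_simps ln_mult)
    finally show ?thesis .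
  qed
  define Z where "Z = {z. norm z = 1 \<and> (\<exists>c. \<forall>i. (norm (poly (\<Phi> (2^i)) z))\<^sup>2 \<le> c * (4/5)^i)}"
  have Z: "finite Z"
    unfolding Z_def
  proof (rule finite_decaying_points[OF D norm_\<alpha>])
    fix z :: complex and k assume "norm z = 1"
    then show "poly (\<Phi> (Suc k)) z = z * poly (\<Phi> k) z - cnj (\<alpha> k) * (z^k * cnj (poly (\<Phi> k) z))"
      by (simp add: recursion poly_reversed_circle degree_\<Phi>)
  qed (simp_all add: \<Phi>_0)
  note dec = assms(6)[unfolded lebesgue_decomposition_def]
  then have sets_sc: "sets \<mu>sc = sets \<mu>" by simp
  have space_sc: "space \<mu>sc = sphere 0 1"
    using sets_eq_imp_space_eq[OF sets_sc] by (simp add: space_M)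
  have le: "emeasure \<mu>sc B \<le> emeasure \<mu> B" if "B \<in> sets \<mu>" for B
    using dec that by (auto intro: order_trans[OF _ order_trans] simp: add_increasing add_increasing2)
  obtain S where S: "S \<in> null_sets circle_lebesgue" "emeasure \<mu>sc (sphere 0 1 - S) = 0"
    using dec by (auto simp: space_M)
  have S_sets: "S \<in> sets \<mu>" using S(1) by (auto simp: sets_M)
  have Z_null: "Z \<in> null_sets \<mu>sc"
  proof -
    have "{z} \<in> null_sets \<mu>sc" if "z \<in> Z" for z
      using that dec singleton_in_sets_circle_borel[of z] by (auto simp: Z_def null_sets_def space_M sets_M)
    then have "(\<Union>z\<in>Z. {z}) \<in> null_sets \<mu>sc" using Z by (intro null_sets_UN' countable_finite) auto
    then show ?thesis by simp
  qed
  \<comment> \<open>Almost every point of \<open>K\<close> has the decay and so lies in the finite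
    set \<open>Z\<close>, which has no mass because \<open>\<mu>sc\<close> has no atoms.\<close>
  have K_null: "emeasure \<mu>sc K = 0" if K: "compact K" "K \<subseteq> S" for K
  proof -
    have KS: "K \<subseteq> sphere 0 1" using K(2) sets.sets_into_space[OF S_sets] by (auto simp: space_M)
    have K_sets: "K \<in> sets \<mu>"
      unfolding sets_M by (rule compact_in_sets_circle_borel[OF K(1) KS])
    have "emeasure circle_lebesgue K \<le> emeasure circle_lebesgue S"
      using S(1) K(2) by (intro emeasure_mono) auto
    then have "emeasure circle_lebesgue K = 0" using S(1) by auto
    from null_compact_AE_decay[OF K(1) KS this D]
    have "AE z in \<mu>. z \<notin> K - Z"
      by eventually_elim (use KS in \<open>auto simp: Z_def\<close>)
    moreover have "K - Z \<in> sets \<mu>" using K_sets Z_null sets_sc by auto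
    ultimately have "emeasure \<mu> (K - Z) = 0" using AE_iff_null_sets by blast
    then have "K - Z \<in> null_sets \<mu>sc"
      using le[of "K - Z"] \<open>K - Z \<in> sets \<mu>\<close> by (simp add: null_sets_def sets_sc)
    then have "(K - Z) \<union> Z \<in> null_sets \<mu>sc" using Z_null by (rule null_sets.Un)
    then show ?thesis using K_sets sets_sc by (auto intro: null_sets_subset[THEN null_setsD1])
  qed
  have "emeasure \<mu>sc S = 0"
  proof -
    \<comment> \<open>Inner regularity is applied to a finite Borel measure on the plane, hence the
      push-forward along the inclusion of the circle.\<close>
    let ?N = "distr \<mu>sc borel (\<lambda>z. z)"
    have m: "(\<lambda>z. z) \<in> \<mu>sc \<rightarrow>\<^sub>M borel"
      unfolding measurable_cong_sets[OF sets_sc[unfolded sets_M] refl] circle_borel_def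
      by (rule measurable_restrict_space1) simp
    have N: "emeasure ?N B = emeasure \<mu>sc B" if "B \<subseteq> sphere 0 1" "B \<in> sets borel" for B
      using that by (simp add: emeasure_distr[OF m] space_sc Int_absorb2)
    have S_borel: "S \<in> sets borel" "S \<subseteq> sphere 0 1"
      using S_sets by (auto simp: sets_M circle_borel_def sets_restrict_space_iff)
    have "emeasure ?N S = (SUP K \<in> {K. K \<subseteq> S \<and> compact K}. emeasure ?N K)"
    proof (rule inner_regular[OF _ _ S_borel(1)])
      have "emeasure ?N (space ?N) = emeasure \<mu>sc (space \<mu>)"
        by (simp add: emeasure_distr[OF m] space_sc space_M)
      also have "\<dots> \<le> 1" using le[OF sets.top] emeasure_space_1 by simp
      finally show "emeasure ?N (space ?N) \<noteq> \<infinity>" by (auto simp: top_unique)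
    qed simp
    also have "\<dots> \<le> 0"
    proof (rule SUP_least)
      fix K assume "K \<in> {K. K \<subseteq> S \<and> compact K}"
      then show "emeasure ?N K \<le> 0"
        using K_null[of K] N[of K] S_borel(2) compact_imp_closed[of K] by auto
    qed
    finally show ?thesis using N[OF S_borel(2,1)] by simp
  qed
  moreover have "emeasure \<mu>sc (sphere 0 1) = emeasure \<mu>sc S + emeasure \<mu>sc (sphere 0 1 - S)"
    using S_sets sets_sc sets.top[of \<mu>sc] sets.sets_into_space[OF S_sets]
    by (subst plus_emeasure) (auto simp: space_sc space_M intro!: arg_cong[where f = "emeasure \<mu>sc"])
  ultimately have "emeasure \<mu>sc (space \<mu>sc) = 0" using S(2) by (simp add: space_sc)
  then have "emeasure \<mu>sc B = 0" if "B \<in> sets \<mu>" for B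
    using emeasure_space[of \<mu>sc B] by simp
  then show ?thesis by (intro measure_eqI) (simp_all add: sets_sc)
qed

end
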